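(* Let $\Sigma_0\in\mathbb{R}^{n\times n}$ be symmetric positive definite and let $\Sigma^*=\Sigma_0$ be the minimizer of $L$. Let $\overrightarrow{W}(t)=(W_1(t),\dots,W_N(t))$, $t\geqslant0$, be the gradient flow $\frac{d}{dt}\overrightarrow{W}(t)=-\nabla L^N(\overrightarrow{W}(t))$ and put $W(t)=W_N(t)\cdots W_1(t)$, $\Sigma(t)=W(t)W(t)^\top$. Assume that the initial weights $W_1(0),\dots,W_N(0)$ are balanced and that $W(0)W(0)^\top$ has modified deficiency margin $c>0$ with respect to $\Sigma_0$. Then for all $t\geqslant0$, $$L(\Sigma(t))-L(\Sigma^* )\leqslant e^{-8Nc^{\frac{2(2N-1)}{N}}Kt}\,\big(L(\Sigma(0))-L(\Sigma^* )\big),$$ where $K=\frac{\sqrt{c^2\lambda_{\min}(\Sigma_0)}}{2C^2}$ and $C=2\big(L(\Sigma(0))+\operatorname{tr}(\Sigma_0)\big)$.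
   Context: A linear network has $N\geqslant1$ layers with widths $d_0=m,d_1,\dots,d_N=n$; parameters are tuples $\overrightarrow{W}=(W_1,\dots,W_N)$ with $W_j\in\mathbb{R}^{d_j\times d_{j-1}}$. For symmetric positive semidefinite $\Sigma\in\mathbb{R}^{n\times n}$, $L(\Sigma)=\operatorname{tr}\big(\Sigma+\Sigma_0-2(\Sigma_0^{1/2}\Sigma\Sigma_0^{1/2})^{1/2}\big)$; $L^N(\overrightarrow{W})=L(WW^\top)$ with $W=W_N\cdots W_1$. Weights are balanced if $W_jW_j^\top=W_{j+1}^\top W_{j+1}$ for all $j\in\{1,\dots,N-1\}$. A positive semidefinite matrix $\Sigma$ has modified deficiency margin $c>0$ with respect to $\Sigma_0$ if $\min_{U\in\mathcal{O}(n)}\|\Sigma^{1/2}-\Sigma_0^{1/2}U\|_F\leqslant\sigma_{\min}(\Sigma_0^{1/2})-c$, where $\mathcal{O}(n)$ is the set of orthogonal $n\times n$ matrices and $\sigma_{\min}$ the smallest singular value. *)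

theory Defs
  imports Complex_Main "Jordan_Normal_Form.Matrix" "Jordan_Normal_Form.Spectral_Radius"
begin

text \<open>
  The layer widths vary with the layer and the depth is arbitrary, so matrices are the
  dynamically sized \<open>real mat\<close>, with explicit carriers.
\<close>

definition mat_trace :: "real mat \<Rightarrow> real" where
  "mat_trace A = (\<Sum>i<dim_row A. A $$ (i, i))"

definition frob_norm :: "real mat \<Rightarrow> real" where
  "frob_norm A = sqrt (\<Sum>i<dim_row A. \<Sum>j<dim_col A. (A $$ (i, j))\<^sup>2)"

definition psd :: "nat \<Rightarrow> real mat \<Rightarrow> bool" where
  "psd n A \<longleftrightarrow> A \<in> carrier_mat n n \<and> transpose_mat A = A \<and>
     (\<forall>v\<in>carrier_vec n. 0 \<le> v \<bullet> (A *\<^sub>v v))"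

definition pos_def :: "nat \<Rightarrow> real mat \<Rightarrow> bool" where
  "pos_def n A \<longleftrightarrow> A \<in> carrier_mat n n \<and> transpose_mat A = A \<and>
     (\<forall>v\<in>carrier_vec n. v \<noteq> 0\<^sub>v n \<longrightarrow> 0 < v \<bullet> (A *\<^sub>v v))"

text \<open>The positive semidefinite square root; meaningful for positive semidefinite arguments.\<close>

definition mat_sqrt :: "real mat \<Rightarrow> real mat" where
  "mat_sqrt A = (THE B. psd (dim_row A) B \<and> B * B = A)"

text \<open>
  The library's \<open>orthogonal_mat\<close> only asks for pairwise orthogonal columns, without
  normalisation, hence the following.
\<close>

definition orth_group :: "nat \<Rightarrow> real mat set" where
  "orth_group n = {U \<in> carrier_mat n n. U * transpose_mat U = 1\<^sub>m n \<and> transpose_mat U * U = 1\<^sub>m n}"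

text \<open>
  \<open>spectrum\<close> here is the set of real eigenvalues; for the symmetric matrices to which it is
  applied these are all eigenvalues. \<open>sigma_min\<close> is meant for square matrices.
\<close>

definition lambda_min :: "real mat \<Rightarrow> real" where
  "lambda_min A = Min (spectrum A)"

definition singular_values :: "real mat \<Rightarrow> real set" where
  "singular_values A = sqrt ` spectrum (transpose_mat A * A)"

definition sigma_min :: "real mat \<Rightarrow> real" where
  "sigma_min A = Min (singular_values A)"

definition BW_loss :: "real mat \<Rightarrow> real mat \<Rightarrow> real" where
  "BW_loss \<Sigma>\<^sub>0 \<Sigma> =
     mat_trace (\<Sigma> + \<Sigma>\<^sub>0 - 2 \<cdot>\<^sub>m mat_sqrt (mat_sqrt \<Sigma>\<^sub>0 * \<Sigma> * mat_sqrt \<Sigma>\<^sub>0))"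

text \<open>
  The minimum over the orthogonal group is written as an infimum of reals; the group is compact
  and the norm continuous, so the infimum is attained.
\<close>

definition modified_deficiency_margin :: "nat \<Rightarrow> real mat \<Rightarrow> real mat \<Rightarrow> real \<Rightarrow> bool" where
  "modified_deficiency_margin n \<Sigma>\<^sub>0 \<Sigma> c \<longleftrightarrow> psd n \<Sigma> \<and> 0 < c \<and>
     (INF U\<in>orth_group n. frob_norm (mat_sqrt \<Sigma> - mat_sqrt \<Sigma>\<^sub>0 * U)) \<le> sigma_min (mat_sqrt \<Sigma>\<^sub>0) - c"

text \<open>
  A parameter tuple is a function of the layer index of which only the values at
  \<open>1, \<dots>, N\<close> matter; \<open>d\<close> gives the widths \<open>d 0, \<dots>, d N\<close>.
\<close>

definition params :: "nat \<Rightarrow> (nat \<Rightarrow> nat) \<Rightarrow> (nat \<Rightarrow> real mat) set" where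
  "params N d = {W. \<forall>j\<in>{1..N}. W j \<in> carrier_mat (d j) (d (j - 1))}"

text \<open>\<open>end_to_end d W N\<close> is the product \<open>W N * \<dots> * W 1\<close>.\<close>

primrec end_to_end :: "(nat \<Rightarrow> nat) \<Rightarrow> (nat \<Rightarrow> real mat) \<Rightarrow> nat \<Rightarrow> real mat" where
  "end_to_end d W 0 = 1\<^sub>m (d 0)"
| "end_to_end d W (Suc k) = W (Suc k) * end_to_end d W k"

definition end_cov :: "nat \<Rightarrow> (nat \<Rightarrow> nat) \<Rightarrow> (nat \<Rightarrow> real mat) \<Rightarrow> real mat" where
  "end_cov N d W = end_to_end d W N * transpose_mat (end_to_end d W N)"

definition net_loss :: "nat \<Rightarrow> (nat \<Rightarrow> nat) \<Rightarrow> real mat \<Rightarrow> (nat \<Rightarrow> real mat) \<Rightarrow> real" where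
  "net_loss N d \<Sigma>\<^sub>0 W = BW_loss \<Sigma>\<^sub>0 (end_cov N d W)"

definition balanced :: "nat \<Rightarrow> (nat \<Rightarrow> real mat) \<Rightarrow> bool" where
  "balanced N W \<longleftrightarrow>
     (\<forall>j\<in>{1..<N}. W j * transpose_mat (W j) = transpose_mat (W (j + 1)) * W (j + 1))"

definition params_inner ::
    "nat \<Rightarrow> (nat \<Rightarrow> nat) \<Rightarrow> (nat \<Rightarrow> real mat) \<Rightarrow> (nat \<Rightarrow> real mat) \<Rightarrow> real" where
  "params_inner N d G H =
     (\<Sum>j\<in>{1..N}. \<Sum>a<d j. \<Sum>b<d (j - 1). G j $$ (a, b) * H j $$ (a, b))"

definition params_norm :: "nat \<Rightarrow> (nat \<Rightarrow> nat) \<Rightarrow> (nat \<Rightarrow> real mat) \<Rightarrow> real" where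
  "params_norm N d H = sqrt (params_inner N d H H)"

text \<open>
  \<open>has_gradient N d f W G\<close>: the function \<open>f\<close> is Frechet differentiable at \<open>W\<close> on the Euclidean
  space \<open>params N d\<close>, and \<open>G\<close> represents its derivative in the Frobenius inner product. On the
  layers \<open>1, \<dots>, N\<close> this determines \<open>G\<close>.
\<close>

definition has_gradient ::
    "nat \<Rightarrow> (nat \<Rightarrow> nat) \<Rightarrow> ((nat \<Rightarrow> real mat) \<Rightarrow> real) \<Rightarrow> (nat \<Rightarrow> real mat) \<Rightarrow> (nat \<Rightarrow> real mat) \<Rightarrow> bool"
  where
  "has_gradient N d f W G \<longleftrightarrow> W \<in> params N d \<and> G \<in> params N d \<and>
     (\<forall>\<epsilon>>0. \<exists>\<delta>>0. \<forall>H\<in>params N d. params_norm N d H < \<delta> \<longrightarrow>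
        \<bar>f (\<lambda>j. W j + H j) - f W - params_inner N d G H\<bar> \<le> \<epsilon> * params_norm N d H)"

text \<open>
  Solutions of \<open>W' = - grad f (W)\<close> on \<open>[0, \<infinity>)\<close>, with a one-sided derivative at \<open>0\<close>. In
  particular \<open>f\<close> has a gradient at every point of the trajectory.
\<close>

definition gradient_flow ::
    "nat \<Rightarrow> (nat \<Rightarrow> nat) \<Rightarrow> ((nat \<Rightarrow> real mat) \<Rightarrow> real) \<Rightarrow> (real \<Rightarrow> nat \<Rightarrow> real mat) \<Rightarrow> bool" where
  "gradient_flow N d f W \<longleftrightarrow> (\<forall>t\<ge>0. W t \<in> params N d \<and>
     (\<exists>G. has_gradient N d f (W t) G \<and>
        (\<forall>j\<in>{1..N}. \<forall>a<d j. \<forall>b<d (j - 1).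
           ((\<lambda>s. W s j $$ (a, b)) has_real_derivative - (G j $$ (a, b))) (at t within {0..}))))"

end

theory Submission
  imports Defs "HOL-Analysis.L2_Norm"
begin

text \<open>
  Write \<open>X = W\<^sub>N \<cdots> W\<^sub>1\<close>. The loss of \<open>X X\<^sup>T\<close> is the least value of \<open>\<parallel>X - B\<parallel>\<^sup>2\<close> over the
  factors \<open>B\<close> of \<open>\<Sigma>\<^sub>0 = B B\<^sup>T\<close>, attained at some \<open>B = T X\<close> with \<open>T\<close> symmetric when \<open>X X\<^sup>T\<close> is
  positive definite. Hence the loss has the same gradient as \<open>\<parallel>X - B\<parallel>\<^sup>2\<close> with \<open>B\<close> fixed, namely
  \<open>2 (W\<^sub>N \<cdots> W\<^bsub>j+1\<^esub>)\<^sup>T (X - B) (W\<^bsub>j-1\<^esub> \<cdots> W\<^sub>1)\<^sup>T\<close> in layer \<open>j\<close>, which shows that balancedness is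
  preserved. The loss decreases along the flow, so it stays below the square of the bound in the
  deficiency margin, and this keeps the singular values of \<open>X\<close> above \<open>c\<close>. For balanced weights
  \<open>X X\<^sup>T = (W\<^sub>N W\<^sub>N\<^sup>T)\<^sup>N\<close>, and the squared norm of the gradient is at least
  \<open>4 N c\<^bsup>2(N-1)/N\<^esup>\<close> times the loss. This rate exceeds the claimed one because
  \<open>c \<le> \<sigma>\<^sub>m\<^sub>i\<^sub>n(\<Sigma>\<^sub>0\<^bsup>1/2\<^esup>)\<close> and \<open>C \<ge> \<lambda>\<^sub>m\<^sub>i\<^sub>n(\<Sigma>\<^sub>0)\<close>; Gronwall's inequality concludes.
\<close>

subsection \<open>The Frobenius inner product\<close>

text \<open>Positive definiteness of \<open>X * transpose_mat X\<close> has to be extracted from the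
  margin. The singular value bound is therefore proved for \<open>X\<close> of any rank, where the
  best partial isometry may leave a part of \<open>\<Sigma>\<^sub>0\<close> uncovered. Nothing is
  circular in time: the loss decreases by the chain rule alone, for whatever gradient the flow
  supplies. So the bound \<open>c\<close> holds on the whole half-line at once, without a
  continuation argument, and the formula for the gradient may rely on it. One obstacle shapes the
  lower bound for the gradient. Multiplication from the right by the transpose of the lower layers
  can have a kernel when the widths differ. It is applied only to \<open>X - T * X\<close>, whose
  rows lie in the row space of \<open>X\<close>, and there it is again governed by powers of
  \<open>R = W N * transpose_mat (W N)\<close>. The eigenvalues of \<open>R\<close> are at least
  \<open>c powr (2 / N)\<close>. Layers above and below \<open>j\<close> contribute exponents
  \<open>N - j\<close> and \<open>j - 1\<close>, whose sum does not depend on \<open>j\<close>; the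
  4 is the square of the 2 in the gradient, and the \<open>N\<close> counts layers.\<close>

lemma Cauchy_Schwarz_sum:
  fixes f g :: "'a \<Rightarrow> real"
  shows "(\<Sum>i\<in>A. f i * g i)\<^sup>2 \<le> (\<Sum>i\<in>A. (f i)\<^sup>2) * (\<Sum>i\<in>A. (g i)\<^sup>2)"
proof -
  have "\<bar>\<Sum>i\<in>A. f i * g i\<bar> \<le> (\<Sum>i\<in>A. \<bar>f i\<bar> * \<bar>g i\<bar>)"
    by (simp add: sum_abs flip: abs_mult)
  also have "\<dots> \<le> L2_set f A * L2_set g A" by (rule L2_set_mult_ineq)
  finally have "\<bar>\<Sum>i\<in>A. f i * g i\<bar>\<^sup>2 \<le> (L2_set f A * L2_set g A)\<^sup>2"
    by (intro power_mono) auto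
  then show ?thesis by (simp add: power_mult_distrib L2_set_def sum_nonneg)
qed

text \<open>The premises are equations between dimensions instead of carriers, so that these laws
  work as conditional rewrite rules: carrier premises would mention widths that the conclusion does
  not determine.\<close>

lemma mult_assoc_dim:
  fixes A B C :: "'a::semiring_0 mat"
  assumes "dim_col A = dim_row B" "dim_col B = dim_row C"
  shows "(A * B) * C = A * (B * C)"
  using assms by (intro assoc_mult_mat[of A "dim_row A" "dim_row B" B "dim_row C" C "dim_col C"]) auto

lemma transpose_mult_dim:
  fixes A B :: "'a::comm_semiring_0 mat"
  assumes "dim_col A = dim_row B"
  shows "transpose_mat (A * B) = transpose_mat B * transpose_mat A"
  using assms by (intro transpose_mult[of A "dim_row A" "dim_row B" B "dim_col B"]) auto

lemma transpose_add_dim: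
  assumes "dim_row A = dim_row B" "dim_col A = dim_col B"
  shows "transpose_mat (A + B) = transpose_mat A + transpose_mat B"
  using assms by (intro eq_matI) auto

lemma transpose_minus_dim:
  assumes "dim_row A = dim_row B" "dim_col A = dim_col B"
  shows "transpose_mat (A - B) = transpose_mat A - transpose_mat B"
  using assms by (intro eq_matI) auto

lemma mult_minus_distrib_dim:
  fixes A B C :: "'a::ring mat"
  assumes "dim_col A = dim_row B" "dim_row B = dim_row C" "dim_col B = dim_col C"
  shows "A * (B - C) = A * B - A * C"
  using assms by (intro mult_minus_distrib_mat[of A "dim_row A" "dim_row B" B "dim_col B"]) auto

lemma minus_mult_distrib_dim:
  fixes A B C :: "'a::ring mat"
  assumes "dim_col A = dim_row C" "dim_row A = dim_row B" "dim_col A = dim_col B"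
  shows "(A - B) * C = A * C - B * C"
  using assms by (intro minus_mult_distrib_mat[of A "dim_row A" "dim_col A" B]) auto

lemma mult_add_distrib_dim:
  fixes A B C :: "'a::semiring_0 mat"
  assumes "dim_col A = dim_row B" "dim_row B = dim_row C" "dim_col B = dim_col C"
  shows "A * (B + C) = A * B + A * C"
  using assms by (intro mult_add_distrib_mat[of A "dim_row A" "dim_row B" B "dim_col B"]) auto

lemma add_mult_distrib_dim:
  fixes A B C :: "'a::semiring_0 mat"
  assumes "dim_col A = dim_row C" "dim_row A = dim_row B" "dim_col A = dim_col B"
  shows "(A + B) * C = A * C + B * C"
  using assms by (intro add_mult_distrib_mat[of A "dim_row A" "dim_col A" B]) auto

lemmas mat_dim_algebra = mult_assoc_dim transpose_mult_dim transpose_add_dim transpose_minus_dim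
  mult_minus_distrib_dim minus_mult_distrib_dim mult_add_distrib_dim add_mult_distrib_dim

lemma index_mult_mat_sum:
  assumes "i < dim_row A" "j < dim_col B" "dim_col A = dim_row B"
  shows "(A * B) $$ (i, j) = (\<Sum>k<dim_col A. A $$ (i, k) * B $$ (k, j))"
  using assms by (auto simp: scalar_prod_def lessThan_atLeast0 intro!: sum.cong)

text \<open>The shape is read off the first argument. Hence symmetry and linearity on the right
  carry dimension premises, while scaling on the left carries none.\<close>

definition frob_inner :: "real mat \<Rightarrow> real mat \<Rightarrow> real" where
  "frob_inner A B = (\<Sum>i<dim_row A. \<Sum>j<dim_col A. A $$ (i, j) * B $$ (i, j))"

lemma frob_inner_commute:
  "dim_row A = dim_row B \<Longrightarrow> dim_col A = dim_col B \<Longrightarrow> frob_inner A B = frob_inner B A"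
  by (simp add: frob_inner_def mult.commute)

lemma frob_inner_add_left:
  "dim_row A = dim_row B \<Longrightarrow> dim_col A = dim_col B \<Longrightarrow>
    frob_inner (A + B) C = frob_inner A C + frob_inner B C"
  by (simp add: frob_inner_def sum.distrib algebra_simps)

lemma frob_inner_add_right:
  "dim_row A = dim_row B \<Longrightarrow> dim_col A = dim_col B \<Longrightarrow> dim_row B = dim_row C \<Longrightarrow> dim_col B = dim_col C \<Longrightarrow>
    frob_inner A (B + C) = frob_inner A B + frob_inner A C"
  by (simp add: frob_inner_def sum.distrib algebra_simps)

lemma frob_inner_minus_left:
  "dim_row A = dim_row B \<Longrightarrow> dim_col A = dim_col B \<Longrightarrow>
    frob_inner (A - B) C = frob_inner A C - frob_inner B C"
  by (simp add: frob_inner_def sum_subtractf algebra_simps)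

lemma frob_inner_minus_right:
  "dim_row A = dim_row B \<Longrightarrow> dim_col A = dim_col B \<Longrightarrow> dim_row B = dim_row C \<Longrightarrow> dim_col B = dim_col C \<Longrightarrow>
    frob_inner A (B - C) = frob_inner A B - frob_inner A C"
  by (simp add: frob_inner_def sum_subtractf algebra_simps)

lemma frob_inner_smult_left: "frob_inner (a \<cdot>\<^sub>m A) B = a * frob_inner A B"
  by (simp add: frob_inner_def sum_distrib_left algebra_simps)

lemma frob_inner_smult_right:
  "dim_row A = dim_row B \<Longrightarrow> dim_col A = dim_col B \<Longrightarrow> frob_inner A (a \<cdot>\<^sub>m B) = a * frob_inner A B"
  by (simp add: frob_inner_def sum_distrib_left algebra_simps)

lemma frob_inner_self_nonneg: "0 \<le> frob_inner A A"
  by (auto simp: frob_inner_def intro!: sum_nonneg)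

lemma frob_inner_self_eq_0:
  assumes "frob_inner A A = 0"
  shows "A = 0\<^sub>m (dim_row A) (dim_col A)"
proof (rule eq_matI)
  fix i j assume "i < dim_row (0\<^sub>m (dim_row A) (dim_col A) :: real mat)"
    "j < dim_col (0\<^sub>m (dim_row A) (dim_col A) :: real mat)"
  then have ij: "i < dim_row A" "j < dim_col A" by auto
  have "(\<Sum>j<dim_col A. A $$ (i, j) * A $$ (i, j)) = 0"
    using assms ij unfolding frob_inner_def by (subst (asm) sum_nonneg_eq_0_iff) (auto intro: sum_nonneg)
  then have "A $$ (i, j) * A $$ (i, j) = 0"
    using ij by (subst (asm) sum_nonneg_eq_0_iff) auto
  then show "A $$ (i, j) = 0\<^sub>m (dim_row A) (dim_col A) $$ (i, j)" using ij by simp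
qed auto

lemma frob_norm_sq: "(frob_norm A)\<^sup>2 = frob_inner A A"
  using frob_inner_self_nonneg[of A] by (simp add: frob_norm_def frob_inner_def power2_eq_square)

text \<open>Together with \<open>frob_inner_mult_right\<close> this adjointness stands in for
  cyclicity of the trace.\<close>

lemma frob_inner_mult_left:
  assumes "dim_col A = dim_row B" "dim_row A = dim_row C" "dim_col B = dim_col C"
  shows "frob_inner (A * B) C = frob_inner B (transpose_mat A * C)"
proof -
  have "frob_inner (A * B) C =
     (\<Sum>i<dim_row A. \<Sum>j<dim_col B. \<Sum>k<dim_col A. A $$ (i, k) * B $$ (k, j) * C $$ (i, j))"
    using assms unfolding frob_inner_def
    by (auto simp: index_mult_mat_sum sum_distrib_right simp del: index_mult_mat(1) intro!: sum.cong)
  also have "\<dots> = (\<Sum>i<dim_row A. \<Sum>k<dim_col A. \<Sum>j<dim_col B. A $$ (i, k) * B $$ (k, j) * C $$ (i, j))"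
    by (intro sum.cong refl sum.swap)
  also have "\<dots> = (\<Sum>k<dim_col A. \<Sum>i<dim_row A. \<Sum>j<dim_col B. A $$ (i, k) * B $$ (k, j) * C $$ (i, j))"
    by (rule sum.swap)
  also have "\<dots> = (\<Sum>k<dim_col A. \<Sum>j<dim_col B. \<Sum>i<dim_row A. A $$ (i, k) * B $$ (k, j) * C $$ (i, j))"
    by (intro sum.cong refl sum.swap)
  also have "\<dots> = frob_inner B (transpose_mat A * C)"
    using assms unfolding frob_inner_def
    by (auto simp: index_mult_mat_sum sum_distrib_left algebra_simps simp del: index_mult_mat(1)
        intro!: sum.cong)
  finally show ?thesis .
qed

lemma frob_inner_transpose:
  assumes "dim_row A = dim_row B" "dim_col A = dim_col B"
  shows "frob_inner (transpose_mat A) (transpose_mat B) = frob_inner A B"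
  using assms unfolding frob_inner_def
  by (simp, subst sum.swap) (auto intro!: sum.cong)

lemma frob_inner_mult_right:
  assumes "dim_col A = dim_row B" "dim_row A = dim_row C" "dim_col B = dim_col C"
  shows "frob_inner (A * B) C = frob_inner A (C * transpose_mat B)"
proof -
  have "frob_inner (A * B) C = frob_inner (transpose_mat B * transpose_mat A) (transpose_mat C)"
    using assms by (simp add: frob_inner_transpose flip: transpose_mult_dim)
  also have "\<dots> = frob_inner (transpose_mat A) (B * transpose_mat C)"
    using assms by (subst frob_inner_mult_left) auto
  also have "\<dots> = frob_inner (transpose_mat A) (transpose_mat (C * transpose_mat B))"
    using assms by (simp add: transpose_mult_dim)
  also have "\<dots> = frob_inner A (C * transpose_mat B)"
    using assms by (intro frob_inner_transpose) auto
  finally show ?thesis .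
qed

lemma mat_trace_mult_transpose:
  assumes "dim_row A = dim_row B" "dim_col A = dim_col B"
  shows "mat_trace (A * transpose_mat B) = frob_inner A B"
  using assms unfolding mat_trace_def frob_inner_def
  by (auto simp: index_mult_mat_sum simp del: index_mult_mat(1) intro!: sum.cong)

lemma mat_trace_add:
  "A \<in> carrier_mat n n \<Longrightarrow> B \<in> carrier_mat n n \<Longrightarrow> mat_trace (A + B) = mat_trace A + mat_trace B"
  by (simp add: mat_trace_def sum.distrib)

lemma mat_trace_minus:
  "A \<in> carrier_mat n n \<Longrightarrow> B \<in> carrier_mat n n \<Longrightarrow> mat_trace (A - B) = mat_trace A - mat_trace B"
  by (simp add: mat_trace_def sum_subtractf)

lemma mat_trace_smult: "A \<in> carrier_mat n n \<Longrightarrow> mat_trace (a \<cdot>\<^sub>m A) = a * mat_trace A"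
  by (simp add: mat_trace_def sum_distrib_left)

lemma frob_inner_Cauchy_Schwarz:
  assumes "dim_row A = dim_row B" "dim_col A = dim_col B"
  shows "(frob_inner A B)\<^sup>2 \<le> frob_inner A A * frob_inner B B"
proof -
  have s: "frob_inner X Y = (\<Sum>p\<in>{..<dim_row A} \<times> {..<dim_col A}. X $$ p * Y $$ p)"
    if "dim_row X = dim_row A" "dim_col X = dim_col A" for X Y
    using that by (simp add: frob_inner_def sum.cartesian_product)
  show ?thesis
    using Cauchy_Schwarz_sum[of "\<lambda>p. A $$ p" "\<lambda>p. B $$ p" "{..<dim_row A} \<times> {..<dim_col A}"] assms
    by (simp add: s power2_eq_square)
qed

lemma frob_norm_nonneg: "0 \<le> frob_norm A"
  by (auto simp: frob_norm_def intro!: sum_nonneg)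

lemma frob_inner_le_norm:
  assumes "dim_row A = dim_row B" "dim_col A = dim_col B"
  shows "frob_inner A B \<le> frob_norm A * frob_norm B"
  using frob_inner_Cauchy_Schwarz[OF assms]
  by - (rule power2_le_imp_le, auto simp: power_mult_distrib frob_norm_sq frob_norm_nonneg)

lemma frob_norm_triangle:
  assumes "dim_row A = dim_row B" "dim_col A = dim_col B"
  shows "frob_norm (A + B) \<le> frob_norm A + frob_norm B"
proof (rule power2_le_imp_le)
  have "(frob_norm (A + B))\<^sup>2 = (frob_norm A)\<^sup>2 + 2 * frob_inner A B + (frob_norm B)\<^sup>2"
    using assms by (simp add: frob_norm_sq frob_inner_add_left frob_inner_add_right frob_inner_commute[of B A])
  also have "\<dots> \<le> (frob_norm A + frob_norm B)\<^sup>2"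
    using frob_inner_le_norm[OF assms] by (simp add: power2_sum)
  finally show "(frob_norm (A + B))\<^sup>2 \<le> (frob_norm A + frob_norm B)\<^sup>2" .
qed (simp add: frob_norm_nonneg)

text \<open>Cauchy-Schwarz bounds each entry of the product by a row norm times a column norm, and
  the double sum of these bounds factors.\<close>

lemma frob_inner_mult_le:
  assumes "dim_col A = dim_row B"
  shows "frob_inner (A * B) (A * B) \<le> frob_inner A A * frob_inner B B"
proof -
  have "frob_inner (A * B) (A * B) = (\<Sum>i<dim_row A. \<Sum>j<dim_col B. (\<Sum>k<dim_col A. A $$ (i, k) * B $$ (k, j))\<^sup>2)"
    using assms by (simp add: frob_inner_def index_mult_mat_sum power2_eq_square del: index_mult_mat(1))
  also have "\<dots> \<le> (\<Sum>i<dim_row A. \<Sum>j<dim_col B. (\<Sum>k<dim_col A. (A $$ (i, k))\<^sup>2) * (\<Sum>k<dim_col A. (B $$ (k, j))\<^sup>2))"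
    by (intro sum_mono Cauchy_Schwarz_sum)
  also have "\<dots> = (\<Sum>i<dim_row A. \<Sum>k<dim_col A. (A $$ (i, k))\<^sup>2) * (\<Sum>j<dim_col B. \<Sum>k<dim_col A. (B $$ (k, j))\<^sup>2)"
    by (simp add: sum_product)
  also have "(\<Sum>j<dim_col B. \<Sum>k<dim_col A. (B $$ (k, j))\<^sup>2) = frob_inner B B"
    using assms by (subst sum.swap) (simp add: frob_inner_def power2_eq_square)
  finally show ?thesis by (simp add: frob_inner_def power2_eq_square)
qed

subsection \<open>Diagonal matrices and positive semidefiniteness\<close>

definition diagm :: "nat \<Rightarrow> (nat \<Rightarrow> real) \<Rightarrow> real mat" where
  "diagm n e = mat n n (\<lambda>(i, j). if i = j then e i else 0)"

lemma diagm_carrier [simp]: "diagm n e \<in> carrier_mat n n"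
  by (simp add: diagm_def)

lemma diagm_dim [simp]: "dim_row (diagm n e) = n" "dim_col (diagm n e) = n"
  by (simp_all add: diagm_def)

lemma transpose_diagm [simp]: "transpose_mat (diagm n e) = diagm n e"
  by (intro eq_matI) (auto simp: diagm_def)

lemma index_diagm_mult:
  assumes "dim_row A = n" "i < n" "j < dim_col A"
  shows "(diagm n e * A) $$ (i, j) = e i * A $$ (i, j)"
proof -
  have "(diagm n e * A) $$ (i, j) = (\<Sum>k<n. diagm n e $$ (i, k) * A $$ (k, j))"
    using assms by (simp add: index_mult_mat_sum del: index_mult_mat(1))
  also have "\<dots> = (\<Sum>k<n. (if i = k then e i * A $$ (i, j) else 0))"
    using assms by (intro sum.cong) (auto simp: diagm_def)
  finally show ?thesis using assms by simp
qed

lemma index_mult_diagm: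
  assumes "dim_col A = n" "i < dim_row A" "j < n"
  shows "(A * diagm n e) $$ (i, j) = A $$ (i, j) * e j"
proof -
  have "(A * diagm n e) $$ (i, j) = (\<Sum>k<n. A $$ (i, k) * diagm n e $$ (k, j))"
    using assms by (simp add: index_mult_mat_sum del: index_mult_mat(1))
  also have "\<dots> = (\<Sum>k<n. (if k = j then A $$ (i, j) * e j else 0))"
    using assms by (intro sum.cong) (auto simp: diagm_def)
  finally show ?thesis using assms by simp
qed

lemma diagm_mult: "diagm n e * diagm n f = diagm n (\<lambda>i. e i * f i)"
  by (intro eq_matI) (auto simp: index_diagm_mult simp del: index_mult_mat(1), auto simp: diagm_def)

lemma diagm_one: "diagm n (\<lambda>i. 1) = 1\<^sub>m n"
  by (intro eq_matI) (auto simp: diagm_def)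

lemma frob_inner_diagm:
  assumes "dim_row Y = n"
  shows "frob_inner Y (diagm n e * Y) = (\<Sum>i<n. e i * (\<Sum>j<dim_col Y. (Y $$ (i, j))\<^sup>2))"
  using assms
  by (simp add: frob_inner_def index_diagm_mult sum_distrib_left power2_eq_square algebra_simps
      del: index_mult_mat(1))

text \<open>A vector is read as a matrix with one column, so that quadratic forms, singular value
  bounds and matrix norms all become statements about \<open>frob_inner\<close>.\<close>

lemma scalar_prod_mult_mat_vec_eq_frob_inner:
  fixes A :: "real mat"
  assumes A: "A \<in> carrier_mat n n" and v: "v \<in> carrier_vec n"
  shows "v \<bullet> (A *\<^sub>v v) = frob_inner (mat n 1 (\<lambda>(i, _). v $ i)) (A * mat n 1 (\<lambda>(i, _). v $ i))"
  using assms
  by (auto simp: frob_inner_def scalar_prod_def lessThan_atLeast0 index_mult_mat_sum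
      simp del: index_mult_mat(1) intro!: sum.cong)

lemma frob_inner_eq_sum_cols:
  fixes A :: "real mat"
  assumes A: "A \<in> carrier_mat n n" and X: "X \<in> carrier_mat n k"
  shows "frob_inner X (A * X) = (\<Sum>j<k. col X j \<bullet> (A *\<^sub>v col X j))"
proof -
  have "(\<Sum>j<k. col X j \<bullet> (A *\<^sub>v col X j)) = (\<Sum>j<k. \<Sum>i<n. X $$ (i, j) * (A * X) $$ (i, j))"
    using assms by (auto simp: scalar_prod_def lessThan_atLeast0 intro!: sum.cong)
  also have "\<dots> = frob_inner X (A * X)"
    using assms by (subst sum.swap) (auto simp: frob_inner_def)
  finally show ?thesis by simp
qed

lemma psd_frob_inner_nonneg:
  assumes A: "psd n A" and X: "dim_row X = n"
  shows "0 \<le> frob_inner X (A * X)"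
proof -
  have "A \<in> carrier_mat n n" using A by (simp add: psd_def)
  then have "frob_inner X (A * X) = (\<Sum>j<dim_col X. col X j \<bullet> (A *\<^sub>v col X j))"
    using X by (intro frob_inner_eq_sum_cols) auto
  also have "\<dots> \<ge> 0" using A X by (auto simp: psd_def intro!: sum_nonneg)
  finally show ?thesis .
qed

lemma psdI_frob_inner:
  assumes "A \<in> carrier_mat n n" "transpose_mat A = A"
    and "\<And>X. X \<in> carrier_mat n 1 \<Longrightarrow> 0 \<le> frob_inner X (A * X)"
  shows "psd n A"
  using assms by (auto simp: psd_def scalar_prod_mult_mat_vec_eq_frob_inner)

lemma psd_carrier: "psd n A \<Longrightarrow> A \<in> carrier_mat n n"
  by (simp add: psd_def)

lemma psd_transpose: "psd n A \<Longrightarrow> transpose_mat A = A"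
  by (simp add: psd_def)

lemma psd_mult_transpose:
  assumes X: "X \<in> carrier_mat n m"
  shows "psd n (X * transpose_mat X)"
proof (rule psdI_frob_inner)
  fix Y :: "real mat" assume Y: "Y \<in> carrier_mat n 1"
  have "frob_inner Y (X * transpose_mat X * Y) = frob_inner (transpose_mat X * Y) (transpose_mat X * Y)"
    using X Y by (simp add: frob_inner_mult_left mult_assoc_dim)
  then show "0 \<le> frob_inner Y (X * transpose_mat X * Y)" by (simp add: frob_inner_self_nonneg)
qed (use X in \<open>auto simp: transpose_mult_dim\<close>)

subsection \<open>The spectral theorem for real symmetric matrices\<close>

text \<open>A complex eigenvector \<open>x + i y\<close> with eigenvalue \<open>a + i b\<close>
  exists. Symmetry equates \<open>y . A x\<close> with \<open>x . A y\<close>, which says that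
  \<open>b\<close> times the squared norm of the eigenvector vanishes. So \<open>b = 0\<close>, and
  whichever of \<open>x\<close> and \<open>y\<close> is nonzero is a real eigenvector; it is
  normalised at the end.\<close>

lemma symmetric_real_eigenvector:
  fixes A :: "real mat"
  assumes A: "A \<in> carrier_mat n n" and sym: "transpose_mat A = A" and n: "0 < n"
  obtains e v where "(\<Sum>i<n. (v i)\<^sup>2) = 1" "\<And>i. i < n \<Longrightarrow> (\<Sum>j<n. A $$ (i, j) * v j) = e * v i"
proof -
  define Ac where "Ac = map_mat complex_of_real A"
  have Ac: "Ac \<in> carrier_mat n n" using A by (simp add: Ac_def)
  obtain l where "eigenvalue Ac l" using spectrum_non_empty[OF Ac n] by (auto simp: spectrum_def)
  then obtain z where z: "z \<in> carrier_vec n" "z \<noteq> 0\<^sub>v n" "Ac *\<^sub>v z = l \<cdot>\<^sub>v z"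
    using Ac by (auto simp: eigenvalue_def eigenvector_def)
  define x y a b where "x = (\<lambda>i. Re (z $ i))" and "y = (\<lambda>i. Im (z $ i))" and "a = Re l" and "b = Im l"
  have ev: "(\<Sum>j<n. of_real (A $$ (i, j)) * z $ j) = l * z $ i" if i: "i < n" for i
  proof -
    have "(\<Sum>j<n. of_real (A $$ (i, j)) * z $ j) = (Ac *\<^sub>v z) $ i"
      using A i z(1) by (auto simp: Ac_def scalar_prod_def lessThan_atLeast0 intro!: sum.cong)
    then show ?thesis using z i by simp
  qed
  have evx: "(\<Sum>j<n. A $$ (i, j) * x j) = a * x i - b * y i" if "i < n" for i
    using arg_cong[OF ev[OF that], of Re] by (simp add: x_def y_def a_def b_def)
  have evy: "(\<Sum>j<n. A $$ (i, j) * y j) = a * y i + b * x i" if "i < n" for i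
    using arg_cong[OF ev[OF that], of Im] by (simp add: x_def y_def a_def b_def)
  have symA: "A $$ (i, j) = A $$ (j, i)" if "i < n" "j < n" for i j
    using arg_cong[OF sym, of "\<lambda>M. M $$ (i, j)"] A that by simp
  have "(\<Sum>i<n. y i * (\<Sum>j<n. A $$ (i, j) * x j)) = (\<Sum>i<n. \<Sum>j<n. A $$ (j, i) * y i * x j)"
    by (auto simp: sum_distrib_left symA intro!: sum.cong)
  also have "\<dots> = (\<Sum>j<n. \<Sum>i<n. A $$ (j, i) * y i * x j)" by (rule sum.swap)
  also have "\<dots> = (\<Sum>i<n. x i * (\<Sum>j<n. A $$ (i, j) * y j))"
    by (auto simp: sum_distrib_left intro!: sum.cong)
  finally have "(\<Sum>i<n. y i * (a * x i - b * y i)) = (\<Sum>i<n. x i * (a * y i + b * x i))"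
    by (simp add: evx evy)
  then have "0 = (\<Sum>i<n. x i * (a * y i + b * x i) - y i * (a * x i - b * y i))"
    by (simp add: sum_subtractf)
  also have "\<dots> = b * (\<Sum>i<n. (x i)\<^sup>2 + (y i)\<^sup>2)"
    unfolding sum_distrib_left by (intro sum.cong refl) (simp add: algebra_simps power2_eq_square)
  finally have b0: "b * (\<Sum>i<n. (x i)\<^sup>2 + (y i)\<^sup>2) = 0" by simp
  have "\<exists>i<n. z $ i \<noteq> 0"
  proof (rule ccontr)
    assume "\<not> ?thesis"
    then have "z = 0\<^sub>v n" using z(1) by (intro eq_vecI) auto
    with z(2) show False by simp
  qed
  then obtain k where k: "k < n" "z $ k \<noteq> 0" by blast
  then have xy: "x k \<noteq> 0 \<or> y k \<noteq> 0" by (auto simp: x_def y_def complex_eq_iff)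
  have "0 < (\<Sum>i<n. (x i)\<^sup>2 + (y i)\<^sup>2)"
    using k xy by (intro sum_pos2[of _ k]) (auto simp: sum_power2_gt_zero_iff)
  with b0 have b: "b = 0" by simp
  obtain u where u: "u k \<noteq> 0" "\<And>i. i < n \<Longrightarrow> (\<Sum>j<n. A $$ (i, j) * u j) = a * u i"
  proof (cases "x k = 0")
    case True
    then show ?thesis using xy evy b that[of y] by simp
  next
    case False
    then show ?thesis using evx b that[of x] by simp
  qed
  define r where "r = sqrt (\<Sum>i<n. (u i)\<^sup>2)"
  have "0 < (\<Sum>i<n. (u i)\<^sup>2)" using k u(1) by (intro sum_pos2[of _ k]) auto
  then have r: "r > 0" "r\<^sup>2 = (\<Sum>i<n. (u i)\<^sup>2)" by (auto simp: r_def)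
  show ?thesis
  proof (rule that[of "\<lambda>i. u i / r" a])
    show "(\<Sum>i<n. (u i / r)\<^sup>2) = 1"
      using r(1) by (simp add: power_divide r(2)[symmetric] flip: sum_divide_distrib)
    fix i assume "i < n"
    then show "(\<Sum>j<n. A $$ (i, j) * (u j / r)) = a * (u i / r)"
      using u(2)[of i] by (simp add: flip: sum_divide_distrib)
  qed
qed

text \<open>The reflection \<open>1 - s w w^T\<close> along \<open>w = v - e_0\<close> exchanges
  \<open>e_0\<close> and \<open>v\<close>. Its scale is
  \<open>s = 2 / |w|^2 = 1 / (1 - v 0)\<close>, because \<open>v\<close> is a unit vector. If
  \<open>v 0 = 1\<close> then \<open>v = e_0\<close> and the identity serves. Being its own inverse,
  \<open>H\<close> replaces the extension of \<open>v\<close> to an orthonormal basis.\<close>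

lemma Householder_reflection:
  fixes v :: "nat \<Rightarrow> real"
  assumes v: "(\<Sum>i<n. (v i)\<^sup>2) = 1" and n: "0 < n"
  obtains H :: "real mat" where "H \<in> carrier_mat n n" "transpose_mat H = H" "H * H = 1\<^sub>m n"
    "\<And>i. i < n \<Longrightarrow> H $$ (i, 0) = v i"
proof (cases "v 0 = 1")
  case True
  have "(\<Sum>i<n. (v i)\<^sup>2) = (v 0)\<^sup>2 + (\<Sum>i\<in>{..<n} - {0}. (v i)\<^sup>2)"
    using n by (intro sum.remove) auto
  with v True have "(\<Sum>i\<in>{..<n} - {0}. (v i)\<^sup>2) = 0" by simp
  then have "v i = 0" if "i < n" "i \<noteq> 0" for i
    using that by (subst (asm) sum_nonneg_eq_0_iff) auto
  then show ?thesis using n True by (intro that[of "1\<^sub>m n"]) auto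
next
  case False
  define w where "w i = v i - (if i = 0 then 1 else 0)" for i :: nat
  define s where "s = 1 / (1 - v 0)"
  define H where "H = mat n n (\<lambda>(i, j). (if i = j then 1 else 0) - s * w i * w j)"
  have "(\<Sum>i<n. (w i)\<^sup>2) = (\<Sum>i<n. (v i)\<^sup>2 + (if i = 0 then 1 - 2 * v 0 else 0))"
    by (intro sum.cong) (auto simp: w_def power2_diff)
  also have "\<dots> = 2 - 2 * v 0" using n v by (simp add: sum.distrib)
  finally have ww: "(\<Sum>i<n. (w i)\<^sup>2) = 2 - 2 * v 0" .
  have sww: "s * (\<Sum>i<n. (w i)\<^sup>2) = 2" using False by (simp add: ww s_def field_simps)
  have H: "H \<in> carrier_mat n n" by (simp add: H_def)
  have HH: "H * H = 1\<^sub>m n"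
  proof (rule eq_matI)
    fix i j assume "i < dim_row (1\<^sub>m n :: real mat)" "j < dim_col (1\<^sub>m n :: real mat)"
    then have ij: "i < n" "j < n" by auto
    have "(H * H) $$ (i, j) = (\<Sum>k<n. H $$ (i, k) * H $$ (k, j))"
      using H ij by (simp add: index_mult_mat_sum del: index_mult_mat(1))
    also have "\<dots> = (\<Sum>k<n. (if k = i then (if i = j then 1 else 0) - s * w i * w j else 0)
        + ((if k = j then - (s * w i * w j) else 0) + s * w i * w j * s * (w k)\<^sup>2))"
      using ij by (intro sum.cong) (auto simp: H_def algebra_simps power2_eq_square)
    also have "\<dots> = (if i = j then 1 else 0) - 2 * (s * w i * w j) + s * w i * w j * (s * (\<Sum>k<n. (w k)\<^sup>2))"
      using ij by (simp only: sum.distrib) (simp add: sum_distrib_left algebra_simps)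
    also have "\<dots> = 1\<^sub>m n $$ (i, j)" using ij by (simp add: sww)
    finally show "(H * H) $$ (i, j) = 1\<^sub>m n $$ (i, j)" .
  qed (use H in auto)
  show ?thesis
  proof (rule that[OF H _ HH])
    show "transpose_mat H = H" by (intro eq_matI) (auto simp: H_def)
    have "s * w 0 = -1" using False by (simp add: s_def w_def field_simps)
    then have "s * w i * w 0 = - w i" for i by (metis mult.assoc mult.commute mult_minus1)
    then have "H $$ (i, 0) = v i" if "i < n" for i
      using that n by (simp add: H_def) (simp add: w_def)
    then show "H $$ (i, 0) = v i" if "i < n" for i using that .
  qed
qed

text \<open>Deflation: conjugation by a reflection whose column 0 is an eigenvector leaves the
  eigenvalue in the corner and zeros in the rest of column 0, hence by symmetry also in row 0. The
  induction hypothesis diagonalises the remaining block.\<close>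

theorem symmetric_spectral_decomposition:
  fixes A :: "real mat"
  assumes "A \<in> carrier_mat n n" "transpose_mat A = A"
  obtains V e where "V \<in> carrier_mat n n" "transpose_mat V * V = 1\<^sub>m n" "V * transpose_mat V = 1\<^sub>m n"
    "A = V * diagm n e * transpose_mat V"
proof -
  have "\<exists>V e. V \<in> carrier_mat n n \<and> transpose_mat V * V = 1\<^sub>m n \<and> V * transpose_mat V = 1\<^sub>m n
      \<and> A = V * diagm n e * transpose_mat V"
    using assms
  proof (induction n arbitrary: A)
    case 0
    then show ?case by (intro exI[of _ "1\<^sub>m 0"] exI) auto
  next
    case (Suc n)
    note A = Suc.prems(1) and sym = Suc.prems(2)
    obtain e0 v where v: "(\<Sum>i<Suc n. (v i)\<^sup>2) = 1"
      and ev: "\<And>i. i < Suc n \<Longrightarrow> (\<Sum>j<Suc n. A $$ (i, j) * v j) = e0 * v i"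
      using symmetric_real_eigenvector[OF A sym] by blast
    obtain H where H: "H \<in> carrier_mat (Suc n) (Suc n)" "transpose_mat H = H" "H * H = 1\<^sub>m (Suc n)"
      and H0: "\<And>i. i < Suc n \<Longrightarrow> H $$ (i, 0) = v i"
      using Householder_reflection[OF v] by blast
    define B where "B = H * (A * H)"
    have B: "B \<in> carrier_mat (Suc n) (Suc n)" using A H by (simp add: B_def)
    have symB: "transpose_mat B = B" using A H sym by (simp add: B_def mat_dim_algebra)
    have AH0: "(A * H) $$ (i, 0) = e0 * H $$ (i, 0)" if "i < Suc n" for i
      using A H(1) that ev[OF that] H0
      by (simp add: index_mult_mat_sum del: index_mult_mat(1) sum.lessThan_Suc)
    have B0: "B $$ (i, 0) = (if i = 0 then e0 else 0)" if i: "i < Suc n" for i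
    proof -
      have "B $$ (i, 0) = (\<Sum>k<Suc n. H $$ (i, k) * (A * H) $$ (k, 0))"
        using A H(1) i by (simp add: B_def index_mult_mat_sum[of i H] del: index_mult_mat(1) sum.lessThan_Suc)
      also have "\<dots> = e0 * (\<Sum>k<Suc n. H $$ (i, k) * H $$ (k, 0))"
        unfolding sum_distrib_left by (intro sum.cong refl) (simp add: AH0 del: index_mult_mat(1))
      also have "(\<Sum>k<Suc n. H $$ (i, k) * H $$ (k, 0)) = (H * H) $$ (i, 0)"
        using H(1) i by (simp add: index_mult_mat_sum del: index_mult_mat(1) sum.lessThan_Suc)
      also have "\<dots> = (if i = 0 then 1 else 0)" using i by (simp add: H(3))
      finally show ?thesis by simp
    qed
    have B0': "B $$ (0, i) = (if i = 0 then e0 else 0)" if i: "i < Suc n" for i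
      using B0[OF i] arg_cong[OF symB, of "\<lambda>M. M $$ (0, i)"] B i by simp
    define C where "C = mat n n (\<lambda>(i, j). B $$ (Suc i, Suc j))"
    have "transpose_mat C = C"
    proof (rule eq_matI)
      fix i j assume "i < dim_row C" "j < dim_col C"
      then show "transpose_mat C $$ (i, j) = C $$ (i, j)"
        using arg_cong[OF symB, of "\<lambda>M. M $$ (Suc i, Suc j)"] B by (simp add: C_def)
    qed (auto simp: C_def)
    then obtain U f where U: "U \<in> carrier_mat n n" "transpose_mat U * U = 1\<^sub>m n" "U * transpose_mat U = 1\<^sub>m n"
      and CU: "C = U * diagm n f * transpose_mat U"
      using Suc.IH[of C] by (auto simp: C_def)
    define e where "e = case_nat e0 f"
    define Z where "Z = four_block_mat (1\<^sub>m 1) (0\<^sub>m 1 n) (0\<^sub>m n 1) U"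
    have Z: "Z \<in> carrier_mat (Suc n) (Suc n)"
      unfolding Z_def by (rule four_block_carrier_mat[of _ 1 1 _ n n, simplified]) (use U in auto)
    have Zt: "transpose_mat Z = four_block_mat (1\<^sub>m 1) (0\<^sub>m 1 n) (0\<^sub>m n 1) (transpose_mat U)"
      unfolding Z_def using U(1) by (subst transpose_four_block_mat[of _ 1 1 _ n _ n]) auto
    have ZZ: "transpose_mat Z * Z = 1\<^sub>m (Suc n)" "Z * transpose_mat Z = 1\<^sub>m (Suc n)"
      unfolding Zt unfolding Z_def using U four_block_one_mat[of 1 n]
      by (subst mult_four_block_mat[of _ 1 1 _ n _ n _ _ 1 _ n]; simp)+
    have D: "diagm (Suc n) e = four_block_mat (e0 \<cdot>\<^sub>m 1\<^sub>m 1) (0\<^sub>m 1 n) (0\<^sub>m n 1) (diagm n f)"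
      by (intro eq_matI) (auto simp: diagm_def e_def split: nat.split)
    have UC: "U * diagm n f * transpose_mat U \<in> carrier_mat n n" using U(1) by (intro carrier_matI) auto
    have "B = four_block_mat (e0 \<cdot>\<^sub>m 1\<^sub>m 1) (0\<^sub>m 1 n) (0\<^sub>m n 1) C"
      using B by (intro eq_matI) (auto simp: C_def B0 B0')
    also have "\<dots> = Z * diagm (Suc n) e * transpose_mat Z"
      unfolding Zt D unfolding Z_def using U(1)
      by (subst mult_four_block_mat[of _ 1 1 _ n _ n _ _ 1 _ n]; simp)
        (subst mult_four_block_mat[of _ 1 1 _ n _ n _ _ 1 _ n]; simp add: CU left_add_zero_mat[OF UC])
    finally have BZ: "B = Z * diagm (Suc n) e * transpose_mat Z" .
    \<comment> \<open>The normal form of \<open>mat_dim_algebra\<close> nests products to the right,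
      so cancellation has to work in front of an arbitrary tail.\<close>
    have HHl: "H * (H * X) = X" if "dim_row X = Suc n" for X
    proof -
      have "H * (H * X) = (H * H) * X" using H(1) that by (simp add: mult_assoc_dim)
      also have "\<dots> = X" unfolding H(3) using that by (intro left_mult_one_mat) auto
      finally show ?thesis .
    qed
    have ZZl: "transpose_mat Z * (Z * X) = X" "Z * (transpose_mat Z * X) = X" if "dim_row X = Suc n" for X
    proof -
      have "transpose_mat Z * (Z * X) = (transpose_mat Z * Z) * X" using Z that by (simp add: mult_assoc_dim)
      also have "\<dots> = X" unfolding ZZ(1) using that by (intro left_mult_one_mat) auto
      finally show "transpose_mat Z * (Z * X) = X" .
      have "Z * (transpose_mat Z * X) = (Z * transpose_mat Z) * X" using Z that by (simp add: mult_assoc_dim)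
      also have "\<dots> = X" unfolding ZZ(2) using that by (intro left_mult_one_mat) auto
      finally show "Z * (transpose_mat Z * X) = X" .
    qed
    have "A = H * B * H"
      using A H by (simp add: B_def mult_assoc_dim HHl right_mult_one_mat[of _ "Suc n" "Suc n"])
    also have "\<dots> = (H * Z) * diagm (Suc n) e * transpose_mat (H * Z)"
      using H Z by (simp add: BZ mat_dim_algebra)
    finally have AZ: "A = (H * Z) * diagm (Suc n) e * transpose_mat (H * Z)" .
    have "transpose_mat (H * Z) * (H * Z) = 1\<^sub>m (Suc n)" "(H * Z) * transpose_mat (H * Z) = 1\<^sub>m (Suc n)"
      using H Z ZZ by (simp_all add: mat_dim_algebra HHl ZZl)
    with AZ H Z show ?case by (intro exI[of _ "H * Z"] exI[of _ e]) simp
  qed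
  then show ?thesis using that by blast
qed

subsection \<open>Functional calculus and positive semidefinite square roots\<close>

locale orth_diag =
  fixes n :: nat and V :: "real mat"
  assumes V: "V \<in> carrier_mat n n" and VtV: "transpose_mat V * V = 1\<^sub>m n" and VVt: "V * transpose_mat V = 1\<^sub>m n"
begin

text \<open>Functional calculus in the eigenbasis given by the columns of \<open>V\<close>: the
  matrix with eigenvalue \<open>e i\<close> on column \<open>i\<close>. Powers, square roots,
  inverses and spectral projections of \<open>fc e\<close> are again \<open>fc\<close> of functions
  of the \<open>e i\<close>.\<close>

definition fc :: "(nat \<Rightarrow> real) \<Rightarrow> real mat" where
  "fc e = V * diagm n e * transpose_mat V"

lemma V_dim [simp]: "dim_row V = n" "dim_col V = n"
  using V by auto

lemma VtV_left: "dim_row X = n \<Longrightarrow> transpose_mat V * (V * X) = X"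
  using left_mult_one_mat[of X n "dim_col X"] by (simp add: VtV flip: mult_assoc_dim)

lemma VVt_left: "dim_row X = n \<Longrightarrow> V * (transpose_mat V * X) = X"
  using left_mult_one_mat[of X n "dim_col X"] by (simp add: VVt flip: mult_assoc_dim)

lemma fc_carrier [simp]: "fc e \<in> carrier_mat n n"
  by (auto simp: fc_def intro!: carrier_matI)

lemma fc_dim [simp]: "dim_row (fc e) = n" "dim_col (fc e) = n"
  by (simp_all add: fc_def)

lemma fc_transpose [simp]: "transpose_mat (fc e) = fc e"
  by (simp add: fc_def mat_dim_algebra)

lemma fc_mult: "fc e * fc f = fc (\<lambda>i. e i * f i)"
  by (simp add: fc_def mult_assoc_dim VtV_left diagm_mult[symmetric])

lemma fc_one: "fc (\<lambda>i. 1) = 1\<^sub>m n"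
  using V by (simp add: fc_def diagm_one VVt right_mult_one_mat[of V n n])

lemma fc_pow: "fc e ^\<^sub>m k = fc (\<lambda>i. e i ^ k)"
proof (induction k)
  case 0
  then show ?case by (simp add: fc_one)
next
  case (Suc k)
  then show ?case by (simp add: fc_mult mult.commute)
qed

text \<open>The weights \<open>e i\<close> multiply squared row norms in the eigenbasis, so spectral
  inequalities reduce to comparing the \<open>e i\<close> one by one.\<close>

lemma frob_inner_fc:
  assumes "dim_row X = n"
  shows "frob_inner X (fc e * X) = (\<Sum>i<n. e i * (\<Sum>j<dim_col X. ((transpose_mat V * X) $$ (i, j))\<^sup>2))"
proof -
  have "frob_inner X (fc e * X) = frob_inner (transpose_mat V * X) (diagm n e * (transpose_mat V * X))"
    using assms by (simp add: fc_def mult_assoc_dim frob_inner_mult_left)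
  also have "\<dots> = (\<Sum>i<n. e i * (\<Sum>j<dim_col X. ((transpose_mat V * X) $$ (i, j))\<^sup>2))"
    using assms by (subst frob_inner_diagm) (simp_all del: index_mult_mat(1))
  finally show ?thesis .
qed

lemma frob_inner_fc_mono:
  assumes "dim_row X = n" "\<And>i. i < n \<Longrightarrow> e i \<le> f i"
  shows "frob_inner X (fc e * X) \<le> frob_inner X (fc f * X)"
  using assms by (simp add: frob_inner_fc del: index_mult_mat(1)) (intro sum_mono mult_right_mono sum_nonneg, auto)

lemma frob_inner_fc_const:
  assumes "dim_row X = n"
  shows "frob_inner X (fc (\<lambda>_. a) * X) = a * frob_inner X X"
proof -
  have "frob_inner X (fc (\<lambda>_. a) * X) = a * frob_inner X (fc (\<lambda>_. 1) * X)"
    using assms by (simp add: frob_inner_fc sum_distrib_left)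
  also have "fc (\<lambda>_. 1) * X = X"
    using assms by (simp add: fc_one left_mult_one_mat[of X n "dim_col X"])
  finally show ?thesis .
qed

lemma psd_fc:
  assumes "\<And>i. i < n \<Longrightarrow> 0 \<le> e i"
  shows "psd n (fc e)"
  by (intro psdI_frob_inner) (use assms in \<open>auto simp: frob_inner_fc intro!: sum_nonneg\<close>)

lemma fc_mult_col: "i < n \<Longrightarrow> fc e *\<^sub>v col V i = e i \<cdot>\<^sub>v col V i"
proof -
  assume i: "i < n"
  have "fc e *\<^sub>v col V i = col (fc e * V) i"
    using i V by (simp add: col_mult2[of _ n n _ n])
  also have "fc e * V = V * diagm n e"
    using right_mult_one_mat[of "V * diagm n e" n n] V by (simp add: fc_def mult_assoc_dim VtV)
  also have "col (V * diagm n e) i = e i \<cdot>\<^sub>v col V i"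
    using i by (intro eq_vecI) (auto simp: index_mult_diagm simp del: index_mult_mat(1))
  finally show ?thesis .
qed

lemma col_V_norm: "i < n \<Longrightarrow> col V i \<bullet> col V i = 1"
  using arg_cong[OF VtV, of "\<lambda>M. M $$ (i, i)"] by simp

lemma col_V_nonzero: "i < n \<Longrightarrow> col V i \<noteq> 0\<^sub>v n"
  using col_V_norm[of i] by auto

lemma psd_fc_nonneg:
  assumes "psd n (fc e)" "i < n"
  shows "0 \<le> e i"
proof -
  have "0 \<le> col V i \<bullet> (fc e *\<^sub>v col V i)" using assms V unfolding psd_def by auto
  also have "\<dots> = e i"
    using assms V by (simp add: fc_mult_col col_V_norm)
  finally show ?thesis .
qed

lemma pos_def_fc_pos:
  assumes "pos_def n (fc e)" "i < n"
  shows "0 < e i"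
proof -
  have "0 < col V i \<bullet> (fc e *\<^sub>v col V i)" 
    using assms V col_V_nonzero[of i] unfolding pos_def_def by auto
  also have "\<dots> = e i"
    using assms V by (simp add: fc_mult_col col_V_norm)
  finally show ?thesis .
qed

lemma eigenvalue_fc: "i < n \<Longrightarrow> eigenvalue (fc e) (e i)"
  unfolding eigenvalue_def eigenvector_def
  using V by (intro exI[of _ "col V i"]) (auto simp: fc_mult_col col_V_nonzero)

lemma mat_trace_fc: "mat_trace (fc e) = (\<Sum>i<n. e i)"
proof -
  have "mat_trace (fc e) = frob_inner (V * diagm n e) V"
    using mat_trace_mult_transpose[of "V * diagm n e" V] by (simp add: fc_def)
  also have "\<dots> = frob_inner (diagm n e) (1\<^sub>m n)" by (simp add: frob_inner_mult_left VtV)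
  also have "\<dots> = (\<Sum>i<n. \<Sum>j<n. (if j = i then e i else 0))"
    unfolding frob_inner_def by (intro sum.cong) (auto simp: diagm_def)
  finally show ?thesis by simp
qed

end

lemma symmetric_fc:
  assumes "A \<in> carrier_mat n n" "transpose_mat A = A"
  obtains V e where "orth_diag n V" "A = orth_diag.fc n V e"
proof -
  obtain V e where *: "V \<in> carrier_mat n n" "transpose_mat V * V = 1\<^sub>m n" "V * transpose_mat V = 1\<^sub>m n"
    and A: "A = V * diagm n e * transpose_mat V"
    using symmetric_spectral_decomposition[OF assms] .
  then interpret orth_diag n V by unfold_locales
  show ?thesis using that[of V e] A by (simp add: fc_def orth_diag_axioms)
qed

lemma psd_sqrt_exists:
  assumes "psd n A"
  shows "\<exists>B. psd n B \<and> B * B = A"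
proof -
  obtain V e where Ve: "orth_diag n V" "A = orth_diag.fc n V e"
    using symmetric_fc[OF psd_carrier[OF assms] psd_transpose[OF assms]] .
  interpret orth_diag n V by fact
  have e: "0 \<le> e i" if "i < n" for i using psd_fc_nonneg[of e] assms Ve that by simp
  have "diagm n (\<lambda>i. sqrt (e i) * sqrt (e i)) = diagm n e"
    using e by (intro eq_matI) (auto simp: diagm_def)
  then have "fc (\<lambda>i. sqrt (e i)) * fc (\<lambda>i. sqrt (e i)) = A" unfolding fc_mult by (simp add: Ve fc_def)
  moreover have "psd n (fc (\<lambda>i. sqrt (e i)))" using e by (intro psd_fc) simp
  ultimately show ?thesis by blast
qed

text \<open>With \<open>A = B * B\<close> and \<open>B\<close> symmetric, the hypothesis says that
  the norm of \<open>B * X\<close> vanishes.\<close>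

lemma psd_frob_inner_eq_0:
  assumes A: "psd n A" and X: "dim_row X = n" and 0: "frob_inner X (A * X) = 0"
  shows "A * X = 0\<^sub>m n (dim_col X)"
proof -
  obtain B where B: "psd n B" "B * B = A" using psd_sqrt_exists[OF A] by blast
  have Bc: "B \<in> carrier_mat n n" and Bt: "transpose_mat B = B" using B by (auto simp: psd_def)
  have "frob_inner (B * X) (B * X) = frob_inner X (A * X)"
    using Bc Bt X by (simp add: frob_inner_mult_left B(2)[symmetric] mult_assoc_dim)
  then have BX: "B * X = 0\<^sub>m n (dim_col X)" using frob_inner_self_eq_0[of "B * X"] 0 Bc by auto
  have "A * X = B * (B * X)" using Bc X by (simp add: B(2)[symmetric] mult_assoc_dim)
  then show ?thesis using Bc by (simp add: BX)
qed

text \<open>With \<open>D = B - C\<close> the traces of \<open>D B D\<close> and \<open>D C D\<close> are nonnegative and add up to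
  that of \<open>D (B\<^sup>2 - C\<^sup>2) = 0\<close>; hence \<open>B D = C D = 0\<close>, so \<open>D\<^sup>2 = 0\<close> and \<open>D = 0\<close> by symmetry.\<close>

lemma psd_sqrt_unique:
  assumes B: "psd n B" and C: "psd n C" and eq: "B * B = C * C"
  shows "B = C"
proof -
  have Bc: "B \<in> carrier_mat n n" and Bt: "transpose_mat B = B" using B by (auto simp: psd_def)
  have Cc: "C \<in> carrier_mat n n" and Ct: "transpose_mat C = C" using C by (auto simp: psd_def)
  note dims [simp] = carrier_matD[OF Bc] carrier_matD[OF Cc]
  define D where "D = B - C"
  have Dc [simp]: "dim_row D = n" "dim_col D = n" by (auto simp: D_def)
  have Dt: "transpose_mat D = D" by (simp add: D_def mat_dim_algebra Bt Ct)
  have "frob_inner D (B * D) + frob_inner D (C * D) = frob_inner D (B * D) + frob_inner D (D * C)"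
    using frob_inner_transpose[of D "C * D"] by (simp add: mat_dim_algebra Dt Ct)
  also have "\<dots> = frob_inner D (B * D + D * C)" by (simp add: frob_inner_add_right)
  \<comment> \<open>The mixed terms \<open>B * C\<close> cancel.\<close>
  also have "B * D + D * C = B * B - C * C"
    by (rule eq_matI) (auto simp: D_def mat_dim_algebra simp del: index_mult_mat(1))
  also have "\<dots> = 0\<^sub>m n n" by (rule eq_matI) (auto simp: eq simp del: index_mult_mat(1))
  also have "frob_inner D (0\<^sub>m n n) = 0" by (simp add: frob_inner_def)
  finally have "frob_inner D (B * D) = 0" "frob_inner D (C * D) = 0"
    using psd_frob_inner_nonneg[OF B, of D] psd_frob_inner_nonneg[OF C, of D] by auto
  then have "B * D = 0\<^sub>m n n" "C * D = 0\<^sub>m n n"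
    using psd_frob_inner_eq_0[OF B, of D] psd_frob_inner_eq_0[OF C, of D] by auto
  then have DD: "D * D = 0\<^sub>m n n" by (subst D_def) (simp add: mat_dim_algebra)
  have "frob_inner D D = frob_inner (1\<^sub>m n) (D * D)"
    using frob_inner_mult_right[of "1\<^sub>m n" D D] left_mult_one_mat[of D n n] by (simp add: Dt)
  also have "\<dots> = 0" by (simp add: DD frob_inner_def)
  finally have D0: "D = 0\<^sub>m n n" using frob_inner_self_eq_0[of D] by simp
  have "B = D + C" by (rule eq_matI) (auto simp: D_def)
  then show ?thesis using D0 Cc by simp
qed

text \<open>Uniqueness is what gives the definite description in \<open>mat_sqrt\<close> its
  meaning.\<close>

lemma mat_sqrt_eqI:
  assumes "psd n B" "B * B = A"
  shows "mat_sqrt A = B"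
proof -
  have n: "dim_row A = n" using assms psd_carrier[of n B] by auto
  show ?thesis unfolding mat_sqrt_def n
    by (rule the_equality) (use assms psd_sqrt_unique in blast)+
qed

lemma mat_sqrt_psd:
  assumes "psd n A"
  shows "psd n (mat_sqrt A)" "mat_sqrt A * mat_sqrt A = A"
  using psd_sqrt_exists[OF assms] mat_sqrt_eqI by metis+

lemma pos_def_imp_psd:
  assumes "pos_def n A"
  shows "psd n A"
  unfolding psd_def
proof (intro conjI ballI)
  fix v :: "real vec" assume v: "v \<in> carrier_vec n"
  show "0 \<le> v \<bullet> (A *\<^sub>v v)"
  proof (cases "v = 0\<^sub>v n")
    case True
    moreover have "A *\<^sub>v 0\<^sub>v n \<in> carrier_vec n" using assms by (auto simp: pos_def_def)
    ultimately show ?thesis by simp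
  next
    case False
    then show ?thesis using assms v by (auto simp: pos_def_def intro: less_imp_le)
  qed
qed (use assms in \<open>auto simp: pos_def_def\<close>)

lemma pos_def_inverse:
  assumes "pos_def n A"
  obtains Ai where "Ai \<in> carrier_mat n n" "transpose_mat Ai = Ai" "A * Ai = 1\<^sub>m n" "Ai * A = 1\<^sub>m n"
proof -
  obtain V e where Ve: "orth_diag n V" "A = orth_diag.fc n V e"
    using symmetric_fc[of A n] assms by (auto simp: pos_def_def)
  interpret orth_diag n V by fact
  have e: "0 < e i" if "i < n" for i using pos_def_fc_pos[of e] assms Ve that by simp
  have "diagm n (\<lambda>i. e i * (1 / e i)) = diagm n (\<lambda>i. 1)" "diagm n (\<lambda>i. (1 / e i) * e i) = diagm n (\<lambda>i. 1)"
    using e by (auto intro!: eq_matI simp: diagm_def less_imp_neq[symmetric])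
  then show ?thesis
    by (intro that[of "fc (\<lambda>i. 1 / e i)"]) (simp_all add: Ve fc_mult fc_one[symmetric], simp_all add: fc_def)
qed

section \<open>Smallest eigenvalues and smallest singular values\<close>

lemma lambda_min_le_frob_inner:
  assumes A: "A \<in> carrier_mat n n" "transpose_mat A = A" and X: "dim_row X = n"
  shows "lambda_min A * frob_inner X X \<le> frob_inner X (A * X)"
proof -
  obtain V e where Ve: "orth_diag n V" "A = orth_diag.fc n V e"
    using symmetric_fc[OF A] .
  interpret orth_diag n V by fact
  have "lambda_min A \<le> e i" if "i < n" for i
    unfolding lambda_min_def using card_finite_spectrum(1)[OF A(1)] eigenvalue_fc[OF that, of e] Ve(2)
    by (intro Min_le) (auto simp: spectrum_def)
  then have "frob_inner X (fc (\<lambda>_. lambda_min A) * X) \<le> frob_inner X (fc e * X)"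
    using X by (intro frob_inner_fc_mono) auto
  then show ?thesis using X Ve by (simp add: frob_inner_fc_const)
qed

lemma spectrum_symmetric_nonempty:
  fixes A :: "real mat"
  assumes A: "A \<in> carrier_mat n n" "transpose_mat A = A" and "0 < n"
  shows "spectrum A \<noteq> {}"
proof -
  obtain V e where Ve: "orth_diag n V" "A = orth_diag.fc n V e"
    using symmetric_fc[OF A] .
  interpret orth_diag n V by fact
  show ?thesis using eigenvalue_fc[OF \<open>0 < n\<close>, of e] Ve by (auto simp: spectrum_def)
qed

lemma lambda_min_nonneg:
  assumes A: "psd n A" and "0 < n"
  shows "0 \<le> lambda_min A"
proof -
  have Ac: "A \<in> carrier_mat n n" "transpose_mat A = A" using A by (auto simp: psd_def)
  have "lambda_min A \<in> spectrum A" unfolding lambda_min_def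
    using card_finite_spectrum(1)[OF Ac(1)] spectrum_symmetric_nonempty[OF Ac assms(2)] by (intro Min_in)
  then obtain v where v: "v \<in> carrier_vec n" "v \<noteq> 0\<^sub>v n" "A *\<^sub>v v = lambda_min A \<cdot>\<^sub>v v"
    using Ac by (auto simp: spectrum_def eigenvalue_def eigenvector_def)
  have "0 \<le> v \<bullet> (A *\<^sub>v v)" using A v(1) unfolding psd_def by blast
  also have "\<dots> = lambda_min A * (v \<bullet> v)" using v by simp
  finally have "0 \<le> lambda_min A * (v \<bullet> v)" .
  moreover have "0 < v \<bullet> v" using v conjugate_square_greater_0_vec[of v n] by simp
  ultimately show ?thesis by (simp add: zero_le_mult_iff)
qed

text \<open>The Gram matrix of \<open>mat_sqrt A\<close> is \<open>A\<close>, and the monotone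
  function \<open>sqrt\<close> commutes with the minimum of a finite nonempty set;
  \<open>0 < n\<close> makes the spectrum nonempty.\<close>

lemma sigma_min_mat_sqrt:
  assumes A: "psd n A" and "0 < n"
  shows "sigma_min (mat_sqrt A) = sqrt (lambda_min A)"
proof -
  have Ac: "A \<in> carrier_mat n n" "transpose_mat A = A" using A by (auto simp: psd_def)
  have "transpose_mat (mat_sqrt A) * mat_sqrt A = A"
    using mat_sqrt_psd[OF A] by (simp add: psd_transpose)
  then show ?thesis
    unfolding sigma_min_def singular_values_def lambda_min_def
    using card_finite_spectrum(1)[OF Ac(1)] spectrum_symmetric_nonempty[OF Ac assms(2)]
    by (subst mono_Min_commute[symmetric]) (auto simp: mono_def)
qed

subsection \<open>The Bures--Wasserstein loss as a distance between factors\<close>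

lemma left_mult_one_dim: "dim_row X = n \<Longrightarrow> 1\<^sub>m n * X = (X :: 'a::semiring_1 mat)"
  by (rule left_mult_one_mat[of X n "dim_col X"]) auto

lemma right_mult_one_dim: "dim_col X = n \<Longrightarrow> X * 1\<^sub>m n = (X :: 'a::semiring_1 mat)"
  by (rule right_mult_one_mat[of X "dim_row X" n]) auto

text \<open>Polar decomposition of a matrix of any rank: \<open>S\<close> is the modulus,
  \<open>S' * M\<close> the partial isometry, and \<open>P\<close> the projection onto the range of
  \<open>S\<close>.\<close>

lemma polar_factor:
  assumes S: "psd n S" and M: "M \<in> carrier_mat n m" and SS: "S * S = M * transpose_mat M"
  obtains S' P where "S' \<in> carrier_mat n n" "transpose_mat S' = S'"
    "P \<in> carrier_mat n n" "transpose_mat P = P" "P * P = P" "S * P = S"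
    "(S' * M) * transpose_mat (S' * M) = P" "frob_inner M (S' * M) = mat_trace S"
proof -
  obtain V e where Ve: "orth_diag n V" "S = orth_diag.fc n V e"
    using symmetric_fc[OF psd_carrier[OF S] psd_transpose[OF S]] .
  interpret orth_diag n V by fact
  \<comment> \<open>Since \<open>1 / 0 = 0\<close>, this is the Moore-Penrose inverse of
    \<open>S\<close>: it vanishes on the kernel.\<close>
  define S' where "S' = fc (\<lambda>i. 1 / e i)"
  define P where "P = fc (\<lambda>i. if e i = 0 then 0 else 1)"
  have [simp]: "dim_row M = n" "dim_col M = m" using M by auto
  have "(S' * M) * transpose_mat (S' * M) = S' * ((M * transpose_mat M) * S')"
    by (simp add: S'_def mat_dim_algebra)
  also have "\<dots> = P" by (simp add: P_def S'_def Ve(2) fc_mult mult_assoc_dim flip: SS)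
  finally have U: "(S' * M) * transpose_mat (S' * M) = P" .
  have "frob_inner M (S' * M) = frob_inner (S' * M) M"
    by (rule frob_inner_commute) (auto simp: S'_def)
  also have "\<dots> = mat_trace ((S' * M) * transpose_mat M)"
    by (subst mat_trace_mult_transpose) (auto simp: S'_def)
  also have "(S' * M) * transpose_mat M = S' * (S * S)"
    unfolding SS by (simp add: S'_def mult_assoc_dim)
  also have "\<dots> = S" by (simp add: S'_def Ve(2) fc_mult)
  finally have tr: "frob_inner M (S' * M) = mat_trace S" .
  show ?thesis
  proof (rule that[OF _ _ _ _ _ _ U tr])
    show "P * P = P" unfolding P_def fc_mult by (rule arg_cong[of _ _ fc]) auto
    show "S * P = S" unfolding P_def Ve(2) fc_mult by (rule arg_cong[of _ _ fc]) auto
  qed (simp_all add: S'_def P_def)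
qed

text \<open>In an eigenbasis of \<open>S\<close> the rows of \<open>M\<close> have the eigenvalues of \<open>S\<close> as norms, while
  those of \<open>Q\<close> are unit vectors.\<close>

lemma frob_inner_le_trace:
  assumes S: "psd n S" and M: "M \<in> carrier_mat n m" and SS: "S * S = M * transpose_mat M"
    and Q: "Q \<in> carrier_mat n m" and QQ: "Q * transpose_mat Q = 1\<^sub>m n"
  shows "frob_inner M Q \<le> mat_trace S"
proof -
  obtain V e where Ve: "orth_diag n V" "S = orth_diag.fc n V e"
    using symmetric_fc[OF psd_carrier[OF S] psd_transpose[OF S]] .
  interpret orth_diag n V by fact
  have e: "0 \<le> e i" if "i < n" for i using psd_fc_nonneg[of e i] S Ve(2) that by simp
  note [simp] = carrier_matD[OF M] carrier_matD[OF Q]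
  define M' Q' where "M' = transpose_mat V * M" and "Q' = transpose_mat V * Q"
  have [simp]: "dim_row M' = n" "dim_col M' = m" "dim_row Q' = n" "dim_col Q' = m"
    by (auto simp: M'_def Q'_def)
  have "M' * transpose_mat M' = transpose_mat V * ((M * transpose_mat M) * V)"
    by (simp add: M'_def mat_dim_algebra)
  also have "\<dots> = diagm n (\<lambda>i. e i * e i)"
    unfolding SS[symmetric] Ve(2) fc_mult
    by (simp add: fc_def mult_assoc_dim VtV VtV_left right_mult_one_dim)
  finally have MM: "M' * transpose_mat M' = diagm n (\<lambda>i. e i * e i)" .
  have "Q' * transpose_mat Q' = transpose_mat V * ((Q * transpose_mat Q) * V)"
    by (simp add: Q'_def mat_dim_algebra)
  also have "\<dots> = 1\<^sub>m n" by (simp add: QQ left_mult_one_dim VtV)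
  finally have QQ': "Q' * transpose_mat Q' = 1\<^sub>m n" .
  have row: "(\<Sum>j<m. M' $$ (i, j) * Q' $$ (i, j)) \<le> e i" if i: "i < n" for i
  proof (rule power2_le_imp_le)
    have "(\<Sum>j<m. (M' $$ (i, j))\<^sup>2) = (M' * transpose_mat M') $$ (i, i)"
      using i by (simp add: index_mult_mat_sum power2_eq_square del: index_mult_mat(1))
    also have "\<dots> = (e i)\<^sup>2" using i unfolding MM by (simp add: diagm_def power2_eq_square)
    finally have 1: "(\<Sum>j<m. (M' $$ (i, j))\<^sup>2) = (e i)\<^sup>2" .
    have "(\<Sum>j<m. (Q' $$ (i, j))\<^sup>2) = (Q' * transpose_mat Q') $$ (i, i)"
      using i by (simp add: index_mult_mat_sum power2_eq_square del: index_mult_mat(1))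
    also have "\<dots> = 1" using i unfolding QQ' by simp
    finally have 2: "(\<Sum>j<m. (Q' $$ (i, j))\<^sup>2) = 1" .
    show "(\<Sum>j<m. M' $$ (i, j) * Q' $$ (i, j))\<^sup>2 \<le> (e i)\<^sup>2"
      using Cauchy_Schwarz_sum[of "\<lambda>j. M' $$ (i, j)" "\<lambda>j. Q' $$ (i, j)" "{..<m}"] 1 2 by simp
  qed (use e i in simp)
  have "frob_inner M Q = frob_inner M' Q'"
    by (simp add: M'_def Q'_def frob_inner_mult_left VVt_left)
  also have "\<dots> = (\<Sum>i<n. \<Sum>j<m. M' $$ (i, j) * Q' $$ (i, j))" by (simp add: frob_inner_def)
  also have "\<dots> \<le> (\<Sum>i<n. e i)" using row by (intro sum_mono) auto
  also have "\<dots> = mat_trace S" by (simp add: Ve(2) mat_trace_fc)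
  finally show ?thesis .
qed

text \<open>With \<open>A = mat_sqrt \<Sigma>\<^sub>0\<close>, the matrix under the outer square
  root of the loss is the Gram matrix of \<open>A * X\<close>. So \<open>S\<close> is the modulus
  from its polar decomposition and \<open>mat_trace S\<close> its nuclear norm.\<close>

lemma BW_loss_factor:
  assumes S0: "psd n \<Sigma>\<^sub>0" and X: "X \<in> carrier_mat n m"
  obtains S where "psd n S"
    "S * S = (mat_sqrt \<Sigma>\<^sub>0 * X) * transpose_mat (mat_sqrt \<Sigma>\<^sub>0 * X)"
    "BW_loss \<Sigma>\<^sub>0 (X * transpose_mat X) = frob_inner X X + mat_trace \<Sigma>\<^sub>0 - 2 * mat_trace S"
proof -
  define A where "A = mat_sqrt \<Sigma>\<^sub>0"
  have A: "A \<in> carrier_mat n n" "transpose_mat A = A"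
    using mat_sqrt_psd[OF S0] by (auto simp: A_def psd_def)
  note [simp] = carrier_matD[OF A(1)] carrier_matD[OF X]
  have eq: "A * (X * transpose_mat X) * A = (A * X) * transpose_mat (A * X)"
    by (simp add: mat_dim_algebra A)
  have "A * X \<in> carrier_mat n m" using A X by auto
  then have psd: "psd n (A * (X * transpose_mat X) * A)" unfolding eq by (rule psd_mult_transpose)
  define S where "S = mat_sqrt (A * (X * transpose_mat X) * A)"
  have S: "psd n S" "S * S = (A * X) * transpose_mat (A * X)"
    using mat_sqrt_psd[OF psd] by (simp_all add: S_def eq)
  have c: "S \<in> carrier_mat n n" "\<Sigma>\<^sub>0 \<in> carrier_mat n n" "X * transpose_mat X \<in> carrier_mat n n"
    using psd_carrier[OF S(1)] psd_carrier[OF S0] by auto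
  have "BW_loss \<Sigma>\<^sub>0 (X * transpose_mat X) = mat_trace (X * transpose_mat X) + mat_trace \<Sigma>\<^sub>0 - 2 * mat_trace S"
    unfolding BW_loss_def A_def[symmetric] S_def[symmetric] using c
    by (simp add: mat_trace_minus[of _ n] mat_trace_add[of _ n] mat_trace_smult[of _ n])
  then show ?thesis using that[of S] S by (simp add: A_def mat_trace_mult_transpose)
qed

lemma frob_inner_diff_self:
  assumes "dim_row A = dim_row B" "dim_col A = dim_col B"
  shows "frob_inner (A - B) (A - B) = frob_inner A A - 2 * frob_inner A B + frob_inner B B"
  using assms by (simp add: frob_inner_minus_left frob_inner_minus_right frob_inner_commute[of B A])

text \<open>The squared distance is the loss formula with \<open>frob_inner X B\<close> in place of
  \<open>mat_trace S\<close>. Writing \<open>B = A * Q\<close>, where \<open>A\<close> is the root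
  of \<open>\<Sigma>\<^sub>0\<close> and \<open>Q\<close> has orthonormal rows, makes this
  \<open>frob_inner (A * X) Q\<close>, which is at most the nuclear norm of
  \<open>A * X\<close>.\<close>

lemma BW_loss_le:
  assumes S0: "pos_def n \<Sigma>\<^sub>0" and X: "X \<in> carrier_mat n m" and B: "B \<in> carrier_mat n m"
    and BB: "B * transpose_mat B = \<Sigma>\<^sub>0"
  shows "BW_loss \<Sigma>\<^sub>0 (X * transpose_mat X) \<le> frob_inner (X - B) (X - B)"
proof -
  have S0': "psd n \<Sigma>\<^sub>0" using S0 by (rule pos_def_imp_psd)
  define A where "A = mat_sqrt \<Sigma>\<^sub>0"
  have A: "A \<in> carrier_mat n n" "transpose_mat A = A" "A * A = \<Sigma>\<^sub>0"
    using mat_sqrt_psd[OF S0'] by (auto simp: A_def psd_def)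
  obtain S where S: "psd n S" "S * S = (A * X) * transpose_mat (A * X)"
    and L: "BW_loss \<Sigma>\<^sub>0 (X * transpose_mat X) = frob_inner X X + mat_trace \<Sigma>\<^sub>0 - 2 * mat_trace S"
    using BW_loss_factor[OF S0' X] by (auto simp: A_def)
  obtain I where I: "I \<in> carrier_mat n n" "transpose_mat I = I" "\<Sigma>\<^sub>0 * I = 1\<^sub>m n" "I * \<Sigma>\<^sub>0 = 1\<^sub>m n"
    using pos_def_inverse[OF S0] .
  note [simp] = carrier_matD[OF A(1)] carrier_matD[OF X] carrier_matD[OF B] carrier_matD[OF I(1)]
    carrier_matD[OF psd_carrier[OF S0']]
  \<comment> \<open>As \<open>I\<close> inverts \<open>A * A\<close>, the product
    \<open>A * I\<close> inverts \<open>A\<close>, and \<open>Q\<close> is the inverse of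
    \<open>A\<close> applied to \<open>B\<close>.\<close>
  define Q where "Q = A * (I * B)"
  have AI: "A * (A * I) = 1\<^sub>m n"
    using I(3) by (simp add: A(3)[symmetric] mult_assoc_dim)
  then have AIA: "(A * I) * A = 1\<^sub>m n"
    by (intro mat_mult_left_right_inverse[of A n "A * I"]) (use A I in \<open>auto\<close>)
  have Q: "Q \<in> carrier_mat n m" by (auto simp: Q_def intro!: carrier_matI)
  have "Q * transpose_mat Q = A * (I * ((B * transpose_mat B) * (I * A)))"
    by (simp add: Q_def mat_dim_algebra A I)
  also have "\<dots> = A * ((I * \<Sigma>\<^sub>0) * (I * A))" by (simp add: BB mult_assoc_dim)
  also have "\<dots> = 1\<^sub>m n" using AIA by (simp add: I left_mult_one_dim mult_assoc_dim)
  finally have QQ: "Q * transpose_mat Q = 1\<^sub>m n" .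
  have "A * Q = (A * (A * I)) * B" by (simp add: Q_def mult_assoc_dim)
  then have AQ: "A * Q = B" by (simp add: AI left_mult_one_dim)
  have "A * X \<in> carrier_mat n m" using A X by auto
  then have "frob_inner (A * X) Q \<le> mat_trace S" using frob_inner_le_trace S Q QQ by blast
  also have "frob_inner (A * X) Q = frob_inner X B"
    using Q by (simp add: frob_inner_mult_left A(2) AQ)
  finally have "frob_inner X B \<le> mat_trace S" .
  moreover have "frob_inner B B = mat_trace \<Sigma>\<^sub>0" by (simp flip: BB add: mat_trace_mult_transpose)
  ultimately show ?thesis by (simp add: L frob_inner_diff_self)
qed

text \<open>For the partial isometry \<open>U = S' * (A * X)\<close> the matrix \<open>A * U\<close>
  is a factor of \<open>A * P * A\<close> only. What is missing from \<open>\<Sigma>\<^sub>0\<close>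
  is \<open>A * (1 - P) * A\<close>, and its trace is the second summand of the loss. The columns of
  \<open>A * X\<close> lie in the range of \<open>P\<close>, whence the vanishing product with
  \<open>transpose_mat X\<close>.\<close>

lemma BW_loss_polar:
  assumes S0: "psd n \<Sigma>\<^sub>0" and X: "X \<in> carrier_mat n m"
  defines "A \<equiv> mat_sqrt \<Sigma>\<^sub>0"
  obtains S' P where "S' \<in> carrier_mat n n" "transpose_mat S' = S'"
    "P \<in> carrier_mat n n" "transpose_mat P = P" "P * P = P"
    "transpose_mat X * (A * (1\<^sub>m n - P)) = 0\<^sub>m m n"
    "(S' * (A * X)) * transpose_mat (S' * (A * X)) = P"
    "BW_loss \<Sigma>\<^sub>0 (X * transpose_mat X) =
      frob_inner (X - A * (S' * (A * X))) (X - A * (S' * (A * X)))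
      + frob_inner ((1\<^sub>m n - P) * A) ((1\<^sub>m n - P) * A)"
proof -
  have A: "A \<in> carrier_mat n n" "transpose_mat A = A" "A * A = \<Sigma>\<^sub>0"
    using mat_sqrt_psd[OF S0] by (auto simp: A_def psd_def)
  obtain S where S: "psd n S" "S * S = (A * X) * transpose_mat (A * X)"
    and L: "BW_loss \<Sigma>\<^sub>0 (X * transpose_mat X) = frob_inner X X + mat_trace \<Sigma>\<^sub>0 - 2 * mat_trace S"
    using BW_loss_factor[OF S0 X] by (auto simp: A_def)
  have AX: "A * X \<in> carrier_mat n m" using A X by auto
  obtain S' P where S': "S' \<in> carrier_mat n n" "transpose_mat S' = S'"
    and P: "P \<in> carrier_mat n n" "transpose_mat P = P" "P * P = P" "S * P = S"
    and U: "(S' * (A * X)) * transpose_mat (S' * (A * X)) = P"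
    and tr: "frob_inner (A * X) (S' * (A * X)) = mat_trace S"
    using polar_factor[OF S(1) AX S(2)] by metis
  note [simp] = carrier_matD[OF A(1)] carrier_matD[OF X] carrier_matD[OF P(1)] carrier_matD[OF S'(1)]
    carrier_matD[OF psd_carrier[OF S0]] carrier_matD[OF psd_carrier[OF S(1)]]
  define U' where "U' = S' * (A * X)"
  have [simp]: "dim_row U' = n" "dim_col U' = m" by (auto simp: U'_def)
  define R where "R = 1\<^sub>m n - P"
  have R [simp]: "dim_row R = n" "dim_col R = n" by (auto simp: R_def)
  have Rt: "transpose_mat R = R" by (simp add: R_def transpose_minus_dim P)
  have RR: "R * R = R"
    by (rule eq_matI) (auto simp: R_def mat_dim_algebra P left_mult_one_dim right_mult_one_dim simp del: index_mult_mat(1))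
  have "S * R = 0\<^sub>m n n"
    by (rule eq_matI) (auto simp: R_def mat_dim_algebra P right_mult_one_dim simp del: index_mult_mat(1))
  then have SR: "S * (S * R) = 0\<^sub>m n n" by (auto intro!: eq_matI)
  have "frob_inner (transpose_mat X * (A * R)) (transpose_mat X * (A * R)) = frob_inner R ((S * S) * R)"
    unfolding S(2) by (simp add: frob_inner_mult_left A mat_dim_algebra)
  also have "\<dots> = 0" using SR by (simp add: mult_assoc_dim frob_inner_def)
  finally have XAR: "transpose_mat X * (A * R) = 0\<^sub>m m n"
    using frob_inner_self_eq_0[of "transpose_mat X * (A * R)"] by simp
  have XU: "frob_inner X (A * U') = mat_trace S"
    using tr by (simp add: U'_def frob_inner_mult_left A)
  have UU: "frob_inner (A * U') (A * U') = frob_inner A (A * P)"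
  proof -
    have "frob_inner (A * U') (A * U') = frob_inner A (A * (U' * transpose_mat U'))"
      by (simp add: frob_inner_mult_right mult_assoc_dim)
    then show ?thesis using U by (simp add: U'_def)
  qed
  have RA: "frob_inner (R * A) (R * A) = frob_inner A A - frob_inner A (A * P)"
  proof -
    have "frob_inner (R * A) (R * A) = frob_inner A (R * A)"
      by (simp add: frob_inner_mult_left Rt RR flip: mult_assoc_dim)
    also have "\<dots> = frob_inner A (A * R)"
      using frob_inner_transpose[of A "R * A"] by (simp add: transpose_mult_dim A Rt)
    also have "\<dots> = frob_inner A A - frob_inner A (A * P)"
      by (simp add: R_def mult_minus_distrib_dim right_mult_one_dim frob_inner_minus_right)
    finally show ?thesis .
  qed
  have trA: "frob_inner A A = mat_trace \<Sigma>\<^sub>0"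
    using mat_trace_mult_transpose[of A A] by (simp add: A)
  have "BW_loss \<Sigma>\<^sub>0 (X * transpose_mat X) =
      frob_inner (X - A * U') (X - A * U') + frob_inner (R * A) (R * A)"
    by (simp add: L frob_inner_diff_self XU UU RA trA)
  then show ?thesis
    using that[OF S' P(1,2,3) _ U] XAR by (simp add: R_def U'_def)
qed

lemma BW_loss_nonneg:
  assumes "psd n \<Sigma>\<^sub>0" "X \<in> carrier_mat n m"
  shows "0 \<le> BW_loss \<Sigma>\<^sub>0 (X * transpose_mat X)"
  using BW_loss_polar[OF assms] by (metis add_nonneg_nonneg frob_inner_self_nonneg)

text \<open>By \<open>BW_loss_polar\<close> the loss is \<open>\<parallel>[X, 0] - [A U, A (1 - P)]\<parallel>\<^sup>2\<close>, where the second
  block matrix is a factor of \<open>\<Sigma>\<^sub>0\<close> and hence has least singular value at least \<open>s\<close>.\<close>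

lemma BW_loss_le_imp_singular_value_bound:
  assumes S0: "psd n \<Sigma>\<^sub>0" and X: "X \<in> carrier_mat n m" and Y: "dim_row Y = n"
    and s: "s\<^sup>2 * frob_inner Y Y \<le> frob_inner Y (\<Sigma>\<^sub>0 * Y)"
    and L: "BW_loss \<Sigma>\<^sub>0 (X * transpose_mat X) \<le> (s - c)\<^sup>2" and c: "0 \<le> c" "c \<le> s"
  shows "c\<^sup>2 * frob_inner Y Y \<le> frob_inner (transpose_mat X * Y) (transpose_mat X * Y)"
proof -
  define A where "A = mat_sqrt \<Sigma>\<^sub>0"
  have A: "A \<in> carrier_mat n n" "transpose_mat A = A" "A * A = \<Sigma>\<^sub>0"
    using mat_sqrt_psd[OF S0] by (auto simp: A_def psd_def)
  obtain S' P where S': "S' \<in> carrier_mat n n" "transpose_mat S' = S'"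
    and P: "P \<in> carrier_mat n n" "transpose_mat P = P" "P * P = P"
    and UU: "(S' * (A * X)) * transpose_mat (S' * (A * X)) = P"
    and LU: "BW_loss \<Sigma>\<^sub>0 (X * transpose_mat X) =
      frob_inner (X - A * (S' * (A * X))) (X - A * (S' * (A * X)))
      + frob_inner ((1\<^sub>m n - P) * A) ((1\<^sub>m n - P) * A)"
    using BW_loss_polar[OF S0 X] unfolding A_def by metis
  note [simp] = carrier_matD[OF A(1)] carrier_matD[OF X] carrier_matD[OF P(1)] carrier_matD[OF S'(1)] Y
  define B where "B = A * (S' * (A * X))"
  define R where "R = 1\<^sub>m n - P"
  define Z where "Z = X - B"
  have [simp]: "dim_row B = n" "dim_col B = m" "dim_row R = n" "dim_col R = n" "dim_row Z = n" "dim_col Z = m"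
    by (auto simp: B_def R_def Z_def)
  have Rt: "transpose_mat R = R" by (simp add: R_def transpose_minus_dim P)
  have RR: "R * R = R"
    by (rule eq_matI) (auto simp: R_def mat_dim_algebra P left_mult_one_dim right_mult_one_dim simp del: index_mult_mat(1))
  have BB: "B * transpose_mat B = A * (P * A)"
    unfolding UU[symmetric] B_def by (simp add: mat_dim_algebra A S')
  define \<beta> \<xi> \<zeta> \<rho> \<eta> where "\<beta> = frob_norm (transpose_mat B * Y)" and "\<xi> = frob_norm (transpose_mat X * Y)"
    and "\<zeta> = frob_norm (transpose_mat Z * Y)" and "\<rho> = frob_norm (R * A * Y)" and "\<eta> = frob_norm Y"
  note nonneg = frob_norm_nonneg[of "transpose_mat B * Y"] frob_norm_nonneg[of "transpose_mat X * Y"]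
    frob_norm_nonneg[of "transpose_mat Z * Y"] frob_norm_nonneg[of "R * A * Y"] frob_norm_nonneg[of Y]
  note nonneg = nonneg[folded \<beta>_def \<xi>_def \<zeta>_def \<rho>_def \<eta>_def]
  \<comment> \<open>Since \<open>P + R\<close> is the identity, \<open>A * P * A\<close> and
    \<open>A * R * A\<close> add up to \<open>\<Sigma>\<^sub>0\<close>.\<close>
  have "\<beta>\<^sup>2 + \<rho>\<^sup>2 = frob_inner Y (A * (P * (A * Y))) + frob_inner Y (A * (R * (A * Y)))"
  proof -
    have "\<beta>\<^sup>2 = frob_inner Y ((B * transpose_mat B) * Y)"
      by (simp add: \<beta>_def frob_norm_sq frob_inner_mult_left mult_assoc_dim)
    moreover have "\<rho>\<^sup>2 = frob_inner Y (A * ((R * R) * (A * Y)))"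
      by (simp add: \<rho>_def frob_norm_sq frob_inner_mult_left mat_dim_algebra A Rt)
    ultimately show ?thesis unfolding BB RR by (simp add: mult_assoc_dim)
  qed
  also have "\<dots> = frob_inner Y (\<Sigma>\<^sub>0 * Y)"
    by (simp add: A(3)[symmetric] R_def mat_dim_algebra left_mult_one_dim frob_inner_minus_right)
  finally have 1: "s\<^sup>2 * \<eta>\<^sup>2 \<le> \<beta>\<^sup>2 + \<rho>\<^sup>2" using s by (simp add: \<eta>_def frob_norm_sq)
  have "\<zeta>\<^sup>2 \<le> frob_inner Z Z * \<eta>\<^sup>2"
    using frob_inner_mult_le[of "transpose_mat Z" Y] by (simp add: \<zeta>_def \<eta>_def frob_norm_sq frob_inner_transpose)
  moreover have "\<rho>\<^sup>2 \<le> frob_inner (R * A) (R * A) * \<eta>\<^sup>2"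
    using frob_inner_mult_le[of "R * A" Y] by (simp add: \<rho>_def \<eta>_def frob_norm_sq)
  ultimately have "\<zeta>\<^sup>2 + \<rho>\<^sup>2 \<le> BW_loss \<Sigma>\<^sub>0 (X * transpose_mat X) * \<eta>\<^sup>2"
    unfolding LU by (simp add: B_def R_def Z_def algebra_simps)
  also have "\<dots> \<le> (s - c)\<^sup>2 * \<eta>\<^sup>2" using L by (intro mult_right_mono) auto
  finally have 2: "\<zeta>\<^sup>2 + \<rho>\<^sup>2 \<le> ((s - c) * \<eta>)\<^sup>2" by (simp add: power_mult_distrib)
  have BY: "transpose_mat B * Y = transpose_mat X * Y + (-1) \<cdot>\<^sub>m (transpose_mat Z * Y)"
    by (rule eq_matI) (auto simp: Z_def mat_dim_algebra simp del: index_mult_mat(1))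
  have "frob_norm ((-1) \<cdot>\<^sub>m (transpose_mat Z * Y)) = \<zeta>"
    unfolding \<zeta>_def frob_norm_def by (intro arg_cong[of _ _ sqrt] sum.cong) (auto simp del: index_mult_mat(1))
  then have 3: "\<beta> \<le> \<xi> + \<zeta>"
    using frob_norm_triangle[of "transpose_mat X * Y" "(-1) \<cdot>\<^sub>m (transpose_mat Z * Y)"]
    by (simp add: \<beta>_def \<xi>_def BY)
  have "\<zeta>\<^sup>2 \<le> ((s - c) * \<eta>)\<^sup>2" using 2 zero_le_power2[of \<rho>] by linarith
  then have 4: "\<zeta> \<le> (s - c) * \<eta>" using c nonneg by - (rule power2_le_imp_le, auto)
  \<comment> \<open>This is the triangle inequality for the pairs \<open>(\<beta>, \<rho>)\<close>,
    \<open>(\<xi>, 0)\<close> and \<open>(\<zeta>, \<rho>)\<close>, written out in squares: the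
    first has norm at least \<open>s * \<eta>\<close>, the last at most
    \<open>(s - c) * \<eta>\<close>.\<close>
  have "(s * \<eta>)\<^sup>2 \<le> (\<xi> + (s - c) * \<eta>)\<^sup>2"
  proof -
    have "\<beta>\<^sup>2 \<le> (\<xi> + \<zeta>)\<^sup>2" using 3 nonneg by (intro power_mono) auto
    then have "(s * \<eta>)\<^sup>2 \<le> (\<xi> + \<zeta>)\<^sup>2 + \<rho>\<^sup>2"
      using 1 by (simp add: power_mult_distrib)
    also have "\<dots> = \<xi>\<^sup>2 + 2 * \<xi> * \<zeta> + (\<zeta>\<^sup>2 + \<rho>\<^sup>2)" by (simp add: power2_sum)
    also have "\<dots> \<le> \<xi>\<^sup>2 + 2 * \<xi> * ((s - c) * \<eta>) + ((s - c) * \<eta>)\<^sup>2"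
      using 2 4 nonneg by (intro add_mono mult_left_mono) auto
    also have "\<dots> = (\<xi> + (s - c) * \<eta>)\<^sup>2" by (simp add: power2_sum)
    finally show ?thesis .
  qed
  then have "s * \<eta> \<le> \<xi> + (s - c) * \<eta>"
    using c nonneg by - (rule power2_le_imp_le, auto)
  then have "c * \<eta> \<le> \<xi>" by (simp add: algebra_simps)
  then have "(c * \<eta>)\<^sup>2 \<le> \<xi>\<^sup>2" using c nonneg by (intro power_mono) auto
  then show ?thesis by (simp add: power_mult_distrib \<eta>_def \<xi>_def frob_norm_sq)
qed

text \<open>The lower bound makes \<open>transpose_mat X\<close> injective, so the relation
  \<open>X^T A (1 - P) = 0\<close> from \<open>BW_loss_polar\<close> gives
  \<open>A * (1 - P) = 0\<close> and, \<open>A\<close> being invertible, \<open>P = 1\<close>. The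
  deficit term disappears and the partial isometry yields a true factor of
  \<open>\<Sigma>\<^sub>0\<close>.\<close>

lemma BW_loss_optimal_factor:
  assumes S0: "pos_def n \<Sigma>\<^sub>0" and X: "X \<in> carrier_mat n m" and c: "0 < c"
    and cX: "\<And>Y. dim_row Y = n \<Longrightarrow>
      c\<^sup>2 * frob_inner Y Y \<le> frob_inner (transpose_mat X * Y) (transpose_mat X * Y)"
  obtains T where "T \<in> carrier_mat n n" "transpose_mat T = T" "(T * X) * transpose_mat (T * X) = \<Sigma>\<^sub>0"
    "BW_loss \<Sigma>\<^sub>0 (X * transpose_mat X) = frob_inner (X - T * X) (X - T * X)"
proof -
  have S0': "psd n \<Sigma>\<^sub>0" using S0 by (rule pos_def_imp_psd)
  define A where "A = mat_sqrt \<Sigma>\<^sub>0"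
  have A: "A \<in> carrier_mat n n" "transpose_mat A = A" "A * A = \<Sigma>\<^sub>0"
    using mat_sqrt_psd[OF S0'] by (auto simp: A_def psd_def)
  obtain S' P where S': "S' \<in> carrier_mat n n" "transpose_mat S' = S'"
    and P: "P \<in> carrier_mat n n" "transpose_mat P = P"
    and XAR: "transpose_mat X * (A * (1\<^sub>m n - P)) = 0\<^sub>m m n"
    and UU: "(S' * (A * X)) * transpose_mat (S' * (A * X)) = P"
    and LU: "BW_loss \<Sigma>\<^sub>0 (X * transpose_mat X) =
      frob_inner (X - A * (S' * (A * X))) (X - A * (S' * (A * X)))
      + frob_inner ((1\<^sub>m n - P) * A) ((1\<^sub>m n - P) * A)"
    using BW_loss_polar[OF S0' X] unfolding A_def by metis
  note [simp] = carrier_matD[OF A(1)] carrier_matD[OF X] carrier_matD[OF P(1)] carrier_matD[OF S'(1)]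
  define R where "R = 1\<^sub>m n - P"
  have [simp]: "dim_row R = n" "dim_col R = n" by (auto simp: R_def)
  have "c\<^sup>2 * frob_inner (A * R) (A * R) \<le> 0"
    using cX[of "A * R"] XAR by (simp add: R_def frob_inner_def del: index_mult_mat(1))
  then have "frob_inner (A * R) (A * R) = 0"
    using c frob_inner_self_nonneg[of "A * R"] by (simp add: mult_le_0_iff)
  then have AR: "A * R = 0\<^sub>m n n" using frob_inner_self_eq_0[of "A * R"] by simp
  obtain I where I: "I \<in> carrier_mat n n" "I * \<Sigma>\<^sub>0 = 1\<^sub>m n"
    using pos_def_inverse[OF S0] by metis
  have "R = I * (A * (A * R))"
    using I by (simp add: A(3)[symmetric] left_mult_one_dim flip: mult_assoc_dim)
  then have R0: "R = 0\<^sub>m n n" using A I by (simp add: AR)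
  have "P = 1\<^sub>m n"
  proof (rule eq_matI)
    fix i j assume "i < dim_row (1\<^sub>m n :: real mat)" "j < dim_col (1\<^sub>m n :: real mat)"
    then show "P $$ (i, j) = 1\<^sub>m n $$ (i, j)"
      using arg_cong[OF R0, of "\<lambda>M. M $$ (i, j)"] by (simp add: R_def)
  qed auto
  \<comment> \<open>With the \<open>S'\<close> built in \<open>polar_factor\<close>, which now
    inverts the square root in the loss, \<open>T\<close> is the optimal transport map between the
    centred Gaussians with covariances \<open>X * transpose_mat X\<close> and
    \<open>\<Sigma>\<^sub>0\<close>.\<close>
  define T where "T = A * (S' * A)"
  have TX: "A * (S' * (A * X)) = T * X" by (simp add: T_def mult_assoc_dim)
  have "(T * X) * transpose_mat (T * X) = A * (P * A)"
    unfolding UU[symmetric] TX[symmetric] by (simp add: mat_dim_algebra A S')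
  also have "\<dots> = \<Sigma>\<^sub>0" by (simp add: \<open>P = 1\<^sub>m n\<close> left_mult_one_dim A)
  finally have TT: "(T * X) * transpose_mat (T * X) = \<Sigma>\<^sub>0" .
  have "frob_inner (R * A) (R * A) = 0" by (simp add: R0 frob_inner_def)
  then show ?thesis
    using LU by (intro that[of T]) (auto simp: TT TX R_def, auto simp: T_def mat_dim_algebra A S' intro!: carrier_matI)
qed

text \<open>The root of \<open>\<Sigma>\<^sub>0\<close> is a factor of it at distance zero from
  itself. Hence the optimal value subtracted in the theorem is zero.\<close>

lemma BW_loss_self:
  assumes S0: "pos_def n \<Sigma>\<^sub>0"
  shows "BW_loss \<Sigma>\<^sub>0 \<Sigma>\<^sub>0 = 0"
proof -
  have S0': "psd n \<Sigma>\<^sub>0" using S0 by (rule pos_def_imp_psd)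
  define A where "A = mat_sqrt \<Sigma>\<^sub>0"
  have A: "A \<in> carrier_mat n n" "A * transpose_mat A = \<Sigma>\<^sub>0"
    using mat_sqrt_psd[OF S0'] by (auto simp: A_def psd_def)
  have "BW_loss \<Sigma>\<^sub>0 \<Sigma>\<^sub>0 \<le> frob_inner (A - A) (A - A)"
    using BW_loss_le[OF S0 A(1) A(1) A(2)] by (simp only: A(2))
  also have "\<dots> = 0" by (simp add: frob_inner_def)
  finally show ?thesis using BW_loss_nonneg[OF S0' A(1)] by (simp add: A(2))
qed

subsection \<open>Products of layers and balanced weights\<close>

text \<open>For \<open>j \<le> k\<close>, \<open>layer_prod d W j k\<close> is the product \<open>W k * \<dots> * W (j + 1)\<close>.\<close>

primrec layer_prod :: "(nat \<Rightarrow> nat) \<Rightarrow> (nat \<Rightarrow> real mat) \<Rightarrow> nat \<Rightarrow> nat \<Rightarrow> real mat" where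
  "layer_prod d W j 0 = 1\<^sub>m (d j)"
| "layer_prod d W j (Suc k) = (if j \<le> k then W (Suc k) * layer_prod d W j k else 1\<^sub>m (d j))"

lemma layer_prod_self [simp]: "layer_prod d W j j = 1\<^sub>m (d j)"
  by (cases j) auto

lemma params_carrier: "W \<in> params N d \<Longrightarrow> 1 \<le> j \<Longrightarrow> j \<le> N \<Longrightarrow> W j \<in> carrier_mat (d j) (d (j - 1))"
  by (auto simp: params_def)

lemma layer_prod_carrier:
  assumes W: "W \<in> params N d" and "j \<le> k" "k \<le> N"
  shows "layer_prod d W j k \<in> carrier_mat (d k) (d j)"
  using assms(2,3)
proof (induction k)
  case (Suc k)
  show ?case
  proof (cases "j = Suc k")
    case False
    then have "j \<le> k" using Suc by simp
    then show ?thesis using Suc params_carrier[OF W, of "Suc k"] by auto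
  qed simp
qed simp

lemma end_to_end_carrier:
  assumes W: "W \<in> params N d" and "k \<le> N"
  shows "end_to_end d W k \<in> carrier_mat (d k) (d 0)"
  using assms(2)
proof (induction k)
  case (Suc k)
  then show ?case using params_carrier[OF W, of "Suc k"] by auto
qed simp

lemma end_to_end_cong:
  assumes "\<And>j. 1 \<le> j \<Longrightarrow> j \<le> k \<Longrightarrow> W j = W' j"
  shows "end_to_end d W k = end_to_end d W' k"
  using assms by (induction k) auto

lemma layer_prod_end_to_end:
  assumes W: "W \<in> params N d" and "j \<le> k" "k \<le> N"
  shows "layer_prod d W j k * end_to_end d W j = end_to_end d W k"
  using assms(2,3)
proof (induction k)
  case 0
  then show ?case by simp
next
  case (Suc k)
  show ?case
  proof (cases "j = Suc k")
    case True
    then show ?thesis using params_carrier[OF W, of j] Suc by (auto simp: left_mult_one_dim)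
  next
    case False
    then have "j \<le> k" using Suc by simp
    then show ?thesis
      using Suc params_carrier[OF W, of "Suc k"] layer_prod_carrier[OF W, of j k] end_to_end_carrier[OF W, of j]
      by (auto simp: mult_assoc_dim)
  qed
qed

text \<open>The recursion exposes the leftmost layer; splitting off the rightmost one links the
  gradients of neighbouring layers and drives the inductions from the top layer down.\<close>

lemma layer_prod_step:
  assumes W: "W \<in> params N d" and j: "1 \<le> j" "j \<le> k" "k \<le> N"
  shows "layer_prod d W (j - 1) k = layer_prod d W j k * W j"
  using assms(3,4)
proof (induction k)
  case 0
  then show ?case using j by simp
next
  case (Suc k)
  show ?case
  proof (cases "j = Suc k")
    case True
    then show ?thesis using params_carrier[OF W, of j] Suc by (auto simp: left_mult_one_dim right_mult_one_dim)
  next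
    case False
    then have "j \<le> k" using Suc by simp
    then show ?thesis
      using Suc params_carrier[OF W, of "Suc k"] layer_prod_carrier[OF W, of j k] params_carrier[OF W, of j] j
      by (auto simp: mult_assoc_dim)
  qed
qed

text \<open>The product is affine in each single layer, so this expansion is exact, with no
  higher-order remainder.\<close>

lemma end_to_end_perturb_layer:
  assumes W: "W \<in> params N d" and j: "1 \<le> j" "j \<le> k" "k \<le> N" and E: "E \<in> carrier_mat (d j) (d (j - 1))"
  shows "end_to_end d (W(j := W j + E)) k = end_to_end d W k + layer_prod d W j k * E * end_to_end d W (j - 1)"
  using assms(3,4)
proof (induction k)
  case 0
  then show ?case using j by simp
next
  case (Suc k)
  have "j - 1 \<le> N" using Suc by simp
  note c = E params_carrier[OF W, of j] end_to_end_carrier[OF W this] layer_prod_carrier[OF W, of j k]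
    params_carrier[OF W, of "Suc k"] end_to_end_carrier[OF W, of k]
  show ?case
  proof (cases "j = Suc k")
    case True
    have "end_to_end d (W(j := W j + E)) k = end_to_end d W k"
      using True by (intro end_to_end_cong) auto
    moreover have "end_to_end d (W(j := W j + E)) (Suc k) = (W j + E) * end_to_end d (W(j := W j + E)) k"
      using True by simp
    ultimately have "end_to_end d (W(j := W j + E)) (Suc k) = (W j + E) * end_to_end d W k" by (simp only:)
    also have "\<dots> = end_to_end d W (Suc k) + layer_prod d W j (Suc k) * E * end_to_end d W (j - 1)"
      using True c Suc by (auto simp: add_mult_distrib_dim left_mult_one_dim)
    finally show ?thesis .
  next
    case False
    then have "j \<le> k" using Suc by simp
    then show ?thesis using Suc c j False by (auto simp: mult_add_distrib_dim mult_assoc_dim)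
  qed
qed

section \<open>Matrix powers and the Gram matrices of balanced products\<close>

lemma pow_mat_commute_mult:
  fixes A :: "'a::semiring_1 mat"
  assumes A: "A \<in> carrier_mat n n"
  shows "A * A ^\<^sub>m k = A ^\<^sub>m k * A"
proof (induction k)
  case 0
  then show ?case using A by (simp add: left_mult_one_dim right_mult_one_dim)
next
  case (Suc k)
  then show ?case using A by (simp flip: mult_assoc_dim)
qed

lemma pow_mat_swap:
  fixes B C :: "'a::semiring_1 mat"
  assumes "B \<in> carrier_mat n m" "C \<in> carrier_mat m n"
  shows "B * (C * B) ^\<^sub>m k = (B * C) ^\<^sub>m k * B"
proof (induction k)
  case 0
  then show ?case using assms by (simp add: left_mult_one_dim right_mult_one_dim)
next
  case (Suc k)
  have [simp]: "dim_row ((C * B) ^\<^sub>m k) = m" "dim_col ((C * B) ^\<^sub>m k) = m"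
    "dim_row ((B * C) ^\<^sub>m k) = n" "dim_col ((B * C) ^\<^sub>m k) = n"
    using assms by auto
  have "B * (C * B) ^\<^sub>m Suc k = (B * (C * B) ^\<^sub>m k) * (C * B)"
    using assms by (simp add: mult_assoc_dim)
  also have "\<dots> = (B * C) ^\<^sub>m Suc k * B"
    unfolding Suc using assms by (simp add: mult_assoc_dim)
  finally show ?case .
qed

lemma pow_mat_add_dim:
  fixes A :: "'a::semiring_1 mat"
  assumes "A \<in> carrier_mat n n"
  shows "A ^\<^sub>m (k + l) = A ^\<^sub>m k * A ^\<^sub>m l"
proof (induction l)
  case 0
  then show ?case using assms by (simp add: right_mult_one_dim)
next
  case (Suc l)
  then show ?case using assms by (simp add: mult_assoc_dim)
qed

context
  fixes N :: nat and d :: "nat \<Rightarrow> nat" and W :: "nat \<Rightarrow> real mat" and R :: "real mat"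
  assumes N: "1 \<le> N" and W: "W \<in> params N d" and bal: "balanced N W"
  defines "R \<equiv> W N * transpose_mat (W N)"
begin

private lemma W_carrier: "1 \<le> j \<Longrightarrow> j \<le> N \<Longrightarrow> W j \<in> carrier_mat (d j) (d (j - 1))"
  by (rule params_carrier[OF W])

private lemma R_carrier: "R \<in> carrier_mat (d N) (d N)"
  using W_carrier[of N] N by (auto simp: R_def intro!: carrier_matI)

private lemma bal_step: "1 \<le> j \<Longrightarrow> j < N \<Longrightarrow>
    W j * transpose_mat (W j) = transpose_mat (W (Suc j)) * W (Suc j)"
  using bal by (simp add: balanced_def)

text \<open>A new layer \<open>w\<close> turns \<open>w (w^T w)^k w^T\<close> into
  \<open>(w w^T)^(k + 1)\<close>, and balancedness rewrites \<open>w w^T\<close> by the layer above.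
  This needs a layer \<open>Suc k\<close>, hence \<open>k < N\<close>.\<close>

lemma balanced_end_to_end_gram:
  "k < N \<Longrightarrow> end_to_end d W k * transpose_mat (end_to_end d W k) = (transpose_mat (W (Suc k)) * W (Suc k)) ^\<^sub>m k"
proof (induction k)
  case 0
  then show ?case using W_carrier[of 1] by (auto simp: left_mult_one_dim)
next
  case (Suc k)
  define w E where "w = W (Suc k)" and "E = end_to_end d W k"
  have w: "w \<in> carrier_mat (d (Suc k)) (d k)" using W_carrier[of "Suc k"] Suc by (simp add: w_def)
  have E: "E \<in> carrier_mat (d k) (d 0)" using end_to_end_carrier[OF W, of k] Suc by (simp add: E_def)
  note [simp] = carrier_matD[OF w] carrier_matD[OF E]
  have "end_to_end d W (Suc k) * transpose_mat (end_to_end d W (Suc k)) = (w * (E * transpose_mat E)) * transpose_mat w"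
    by (simp add: w_def[symmetric] E_def[symmetric] mat_dim_algebra)
  also have "E * transpose_mat E = (transpose_mat w * w) ^\<^sub>m k"
    using Suc by (simp add: w_def E_def)
  also have "w * (transpose_mat w * w) ^\<^sub>m k = (w * transpose_mat w) ^\<^sub>m k * w"
    by (rule pow_mat_swap[OF w]) (use w in auto)
  also have "\<dots> * transpose_mat w = (w * transpose_mat w) ^\<^sub>m Suc k"
    by (simp add: mult_assoc_dim)
  also have "w * transpose_mat w = transpose_mat (W (Suc (Suc k))) * W (Suc (Suc k))"
    using bal_step[of "Suc k"] Suc by (simp add: w_def)
  finally show ?case .
qed

text \<open>Each balance equation lets the Gram matrix climb past one layer, until at the top it
  emerges on the left as \<open>R\<close>.\<close>

lemma balanced_layer_prod_intertwine:
  assumes "j < N"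
  shows "layer_prod d W j N * (transpose_mat (W (Suc j)) * W (Suc j)) = R * layer_prod d W j N"
  using assms
proof (induction "N - Suc j" arbitrary: j)
  case 0
  then have j: "Suc j = N" "j = N - 1" by auto
  have "layer_prod d W j N = W N"
    using layer_prod_step[OF W, of N N] W_carrier[of N] N j by (auto simp: left_mult_one_dim)
  then show ?case using j W_carrier[of N] N by (auto simp: R_def mult_assoc_dim)
next
  case (Suc x)
  then have j: "Suc j < N" by simp
  define P w where "P = layer_prod d W (Suc j) N" and "w = W (Suc j)"
  have P: "P \<in> carrier_mat (d N) (d (Suc j))" using layer_prod_carrier[OF W, of "Suc j" N] j by (simp add: P_def)
  have w: "w \<in> carrier_mat (d (Suc j)) (d j)" using W_carrier[of "Suc j"] j by (simp add: w_def)
  note [simp] = carrier_matD[OF w] carrier_matD[OF P] carrier_matD[OF R_carrier]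
  have Pw: "layer_prod d W j N = P * w" using layer_prod_step[OF W, of "Suc j" N] j by (simp add: P_def w_def)
  have "(P * w) * (transpose_mat w * w) = (P * (w * transpose_mat w)) * w" by (simp add: mult_assoc_dim)
  also have "P * (w * transpose_mat w) = R * P"
    using Suc.hyps(1)[of "Suc j"] Suc.hyps(2) j bal_step[of "Suc j"] by (simp add: P_def w_def)
  finally show ?case unfolding Pw w_def[symmetric] by (simp add: mult_assoc_dim)
qed

text \<open>All products ending at the top layer share the output space, so their Gram matrices can
  be powers of one matrix. A further layer \<open>w\<close> inserts
  \<open>w * transpose_mat w\<close>, which comes out on the left as a factor
  \<open>R\<close>.\<close>

lemma balanced_layer_prod_gram:
  assumes "j \<le> N"
  shows "layer_prod d W j N * transpose_mat (layer_prod d W j N) = R ^\<^sub>m (N - j)"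
  using assms
proof (induction "N - j" arbitrary: j)
  case 0
  then show ?case using R_carrier by (simp add: left_mult_one_dim)
next
  case (Suc x)
  then have j: "Suc j \<le> N" by simp
  define P w where "P = layer_prod d W (Suc j) N" and "w = W (Suc j)"
  have P: "P \<in> carrier_mat (d N) (d (Suc j))" using layer_prod_carrier[OF W, of "Suc j" N] j by (simp add: P_def)
  have w: "w \<in> carrier_mat (d (Suc j)) (d j)" using W_carrier[of "Suc j"] j by (simp add: w_def)
  note [simp] = carrier_matD[OF w] carrier_matD[OF P] carrier_matD[OF R_carrier]
  have Pw: "layer_prod d W j N = P * w" using layer_prod_step[OF W, of "Suc j" N] j by (simp add: P_def w_def)
  have IH: "P * transpose_mat P = R ^\<^sub>m (N - Suc j)" using Suc.hyps(1)[of "Suc j"] Suc.hyps(2) j by (simp add: P_def)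
  have Nj: "N - j = Suc (N - Suc j)" using j by simp
  have "(P * w) * transpose_mat (P * w) = (P * (w * transpose_mat w)) * transpose_mat P"
    by (simp add: mat_dim_algebra)
  also have "P * (w * transpose_mat w) = R * P"
  \<comment> \<open>At the top layer \<open>w * transpose_mat w\<close> is \<open>R\<close> itself;
    below it, a balance equation is needed before intertwining.\<close>
  proof (cases "Suc j = N")
    case True
    then show ?thesis
      by (simp add: P_def w_def True left_mult_one_dim right_mult_one_dim flip: R_def)
  next
    case False
    then show ?thesis
      using balanced_layer_prod_intertwine[of "Suc j"] bal_step[of "Suc j"] j by (simp add: P_def w_def)
  qed
  also have "(R * P) * transpose_mat P = R ^\<^sub>m (N - j)"
    unfolding Nj by (simp add: mult_assoc_dim IH pow_mat_commute_mult[OF R_carrier])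
  finally show ?case unfolding Pw .
qed

lemma balanced_end_cov: "end_cov N d W = R ^\<^sub>m N"
proof -
  have "layer_prod d W 0 N = end_to_end d W N"
    using layer_prod_end_to_end[OF W, of 0 N] layer_prod_carrier[OF W, of 0 N] by (simp add: right_mult_one_dim)
  then show ?thesis using balanced_layer_prod_gram[of 0] by (simp add: end_cov_def)
qed

text \<open>With \<open>X = P * E\<close> and \<open>G\<close> the Gram matrix of layer
  \<open>Suc k\<close>, the product is \<open>P G^(2 k) P^T\<close>, that is \<open>R^(2 k)\<close>
  times \<open>R^(N - k)\<close>. It measures multiplication by \<open>transpose_mat E\<close> on
  matrices of the form \<open>F * X\<close>.\<close>

lemma balanced_mixed_gram:
  assumes k: "k < N"
  shows "end_to_end d W N * (transpose_mat (end_to_end d W k) *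
    (end_to_end d W k * transpose_mat (end_to_end d W N))) = R ^\<^sub>m (N + k)"
proof -
  define P E w where "P = layer_prod d W k N" and "E = end_to_end d W k" and "w = W (Suc k)"
  have P: "P \<in> carrier_mat (d N) (d k)" using layer_prod_carrier[OF W, of k N] k by (simp add: P_def)
  have E: "E \<in> carrier_mat (d k) (d 0)" using end_to_end_carrier[OF W, of k] k by (simp add: E_def)
  have w: "w \<in> carrier_mat (d (Suc k)) (d k)" using W_carrier[of "Suc k"] k by (simp add: w_def)
  define G where "G = transpose_mat w * w"
  have G: "G \<in> carrier_mat (d k) (d k)" using w by (auto simp: G_def)
  note [simp] = carrier_matD[OF w] carrier_matD[OF P] carrier_matD[OF E] carrier_matD[OF G] carrier_matD[OF R_carrier]
  have PE: "end_to_end d W N = P * E" using layer_prod_end_to_end[OF W, of k N] k by (simp add: P_def E_def)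
  have EE: "E * transpose_mat E = G ^\<^sub>m k" using balanced_end_to_end_gram[OF k] by (simp add: E_def G_def w_def)
  have PG: "P * G ^\<^sub>m l = R ^\<^sub>m l * P" for l
  proof (induction l)
    case 0
    then show ?case by (simp add: left_mult_one_dim right_mult_one_dim)
  next
    case (Suc l)
    have "P * G ^\<^sub>m Suc l = (P * G ^\<^sub>m l) * G" by (simp add: mult_assoc_dim)
    also have "\<dots> = R ^\<^sub>m l * (P * G)" unfolding Suc by (simp add: mult_assoc_dim)
    also have "P * G = R * P" using balanced_layer_prod_intertwine[OF k] by (simp add: P_def G_def w_def)
    finally show ?case by (simp add: mult_assoc_dim)
  qed
  have "end_to_end d W N * (transpose_mat E * (E * transpose_mat (end_to_end d W N))) =
      P * ((E * transpose_mat E) * ((E * transpose_mat E) * transpose_mat P))"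
    by (simp add: PE mat_dim_algebra)
  also have "\<dots> = (P * G ^\<^sub>m k) * (G ^\<^sub>m k * transpose_mat P)"
    unfolding EE by (simp add: mult_assoc_dim)
  also have "\<dots> = R ^\<^sub>m k * ((P * G ^\<^sub>m k) * transpose_mat P)"
    unfolding PG by (simp add: mult_assoc_dim) (simp add: PG flip: mult_assoc_dim)
  also have "\<dots> = R ^\<^sub>m k * (R ^\<^sub>m k * R ^\<^sub>m (N - k))"
    unfolding PG using balanced_layer_prod_gram[of k] k by (simp add: mult_assoc_dim P_def[symmetric])
  also have "\<dots> = R ^\<^sub>m (k + (k + (N - k)))" by (simp add: pow_mat_add_dim[OF R_carrier])
  also have "k + (k + (N - k)) = N + k" using k by simp
  finally show ?thesis by (simp add: E_def)
qed

end

text \<open>Singular values of the end-to-end matrix control only the power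
  \<open>R ^\<^sub>m N\<close>. Testing with eigenvectors and taking roots, possible as
  \<open>N\<close> is positive, bounds every eigenvalue of \<open>R\<close> by \<open>r\<close> from
  below, and then all powers.\<close>

lemma psd_pow_lower_bound:
  assumes R: "psd n R" and r: "0 \<le> r"
    and RN: "\<And>Y. dim_row Y = n \<Longrightarrow> r ^ N * frob_inner Y Y \<le> frob_inner Y (R ^\<^sub>m N * Y)"
    and N: "1 \<le> N" and Y: "dim_row Y = n"
  shows "r ^ k * frob_inner Y (R ^\<^sub>m l * Y) \<le> frob_inner Y (R ^\<^sub>m (k + l) * Y)"
proof -
  obtain V e where Ve: "orth_diag n V" "R = orth_diag.fc n V e"
    using symmetric_fc[OF psd_carrier[OF R] psd_transpose[OF R]] .
  interpret orth_diag n V by fact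
  have e0: "0 \<le> e i" if "i < n" for i using psd_fc_nonneg[of e i] R Ve(2) that by simp
  have re: "r \<le> e i" if i: "i < n" for i
  proof -
    define v where "v = mat n 1 (\<lambda>(k, _). V $$ (k, i))"
    have vv: "frob_inner v v = 1"
      using col_V_norm[OF i] by (simp add: v_def frob_inner_def scalar_prod_def lessThan_atLeast0 i)
    have "frob_inner v (R ^\<^sub>m N * v) = col V i \<bullet> (fc (\<lambda>i. e i ^ N) *\<^sub>v col V i)"
    proof -
      have "v = mat n 1 (\<lambda>(k, _). col V i $ k)" using i by (auto simp: v_def)
      then show ?thesis
        using scalar_prod_mult_mat_vec_eq_frob_inner[of "fc (\<lambda>i. e i ^ N)" n "col V i"] i V
        by (simp add: Ve(2) fc_pow)
    qed
    also have "\<dots> = e i ^ N" using i V by (simp add: fc_mult_col col_V_norm)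
    finally have "r ^ N \<le> e i ^ N" using RN[of v] vv by (simp add: v_def)
    then show "r \<le> e i" using e0[OF i] N r by (simp add: power_mono_iff)
  qed
  have sm: "diagm n (\<lambda>i. r ^ k * e i ^ l) = r ^ k \<cdot>\<^sub>m diagm n (\<lambda>i. e i ^ l)"
    by (intro eq_matI) (auto simp: diagm_def)
  have "r ^ k * frob_inner Y (R ^\<^sub>m l * Y) = frob_inner Y (fc (\<lambda>i. r ^ k * e i ^ l) * Y)"
    using Y by (simp add: Ve(2) fc_pow frob_inner_fc sum_distrib_left algebra_simps del: index_mult_mat(1))
  also have "\<dots> \<le> frob_inner Y (fc (\<lambda>i. e i ^ (k + l)) * Y)"
    using Y re e0 r by (intro frob_inner_fc_mono) (auto simp: power_add intro!: mult_right_mono power_mono)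
  also have "\<dots> = frob_inner Y (R ^\<^sub>m (k + l) * Y)" by (simp add: Ve(2) fc_pow)
  finally show ?thesis .
qed

text \<open>The upper layers \<open>P\<close> act through \<open>P * transpose_mat P\<close>, a
  power of \<open>R\<close>. The lower layers \<open>E\<close> admit no such bound on all matrices,
  but \<open>D = F * X\<close>: after transposition they act on
  \<open>transpose_mat X * (F * P)\<close>, where \<open>balanced_mixed_gram\<close>
  applies.\<close>

lemma balanced_gradient_lower_bound:
  assumes N: "1 \<le> N" and W: "W \<in> params N d" and bal: "balanced N W"
    and r: "0 \<le> r" and rW: "\<And>Y. dim_row Y = d N \<Longrightarrow>
      r ^ N * frob_inner Y Y \<le> frob_inner (transpose_mat (end_to_end d W N) * Y) (transpose_mat (end_to_end d W N) * Y)"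
    and F: "F \<in> carrier_mat (d N) (d N)" "transpose_mat F = F" and j: "1 \<le> j" "j \<le> N"
  defines "D \<equiv> F * end_to_end d W N"
  defines "G \<equiv> transpose_mat (layer_prod d W j N) * D * transpose_mat (end_to_end d W (j - 1))"
  shows "r ^ (N - 1) * frob_inner D D \<le> frob_inner G G"
proof -
  define P E X R where "P = layer_prod d W j N" and "E = end_to_end d W (j - 1)" and "X = end_to_end d W N"
    and "R = W N * transpose_mat (W N)"
  have P: "P \<in> carrier_mat (d N) (d j)" using layer_prod_carrier[OF W, of j N] j by (simp add: P_def)
  have E: "E \<in> carrier_mat (d (j - 1)) (d 0)" using end_to_end_carrier[OF W, of "j - 1"] j by (simp add: E_def)
  have X: "X \<in> carrier_mat (d N) (d 0)" using end_to_end_carrier[OF W, of N] by (simp add: X_def)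
  have R: "psd (d N) R" unfolding R_def using params_carrier[OF W, of N] N by (intro psd_mult_transpose) auto
  have Rc: "R \<in> carrier_mat (d N) (d N)" using R by (rule psd_carrier)
  note [simp] = carrier_matD[OF P] carrier_matD[OF E] carrier_matD[OF X] carrier_matD[OF F(1)] carrier_matD[OF Rc]
  have XX: "X * transpose_mat X = R ^\<^sub>m N"
    using balanced_end_cov[OF N W bal] by (simp add: end_cov_def X_def R_def)
  have PP: "P * transpose_mat P = R ^\<^sub>m (N - j)"
    using balanced_layer_prod_gram[OF N W bal j(2)] by (simp add: P_def R_def)
  have RN: "r ^ N * frob_inner Y Y \<le> frob_inner Y (R ^\<^sub>m N * Y)" if "dim_row Y = d N" for Y
    using rW[OF that] that unfolding XX[symmetric] X_def[symmetric] by (simp add: frob_inner_mult_left mult_assoc_dim)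
  note low = psd_pow_lower_bound[OF R r RN N]
  have Dd1: "D = F * X" by (simp add: D_def X_def)
  have "G = transpose_mat P * D * transpose_mat E" unfolding G_def P_def E_def ..
  then have Dd: "D = F * X" "G = transpose_mat P * (D * transpose_mat E)"
    using Dd1 by (simp_all add: mult_assoc_dim)
  \<comment> \<open>The exponent is split into \<open>j - 1\<close> for the layers below and
    \<open>N - j\<close> for those above; \<open>R ^\<^sub>m 0\<close> gives the term the shape
    required by \<open>low\<close>.\<close>
  have "r ^ (N - 1) * frob_inner D D = r ^ (j - 1) * (r ^ (N - j) * frob_inner D (R ^\<^sub>m 0 * D))"
    using j by (simp add: Dd(1) left_mult_one_dim flip: power_add)
  also have "\<dots> \<le> r ^ (j - 1) * frob_inner D (R ^\<^sub>m (N - j) * D)"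
    using low[of D "N - j" 0] r by (intro mult_left_mono) (auto simp: Dd(1))
  also have "frob_inner D (R ^\<^sub>m (N - j) * D) = frob_inner (transpose_mat P * D) (transpose_mat P * D)"
    unfolding PP[symmetric] by (simp add: frob_inner_mult_left[of "transpose_mat P"] mult_assoc_dim Dd(1))
  also have "\<dots> = frob_inner (transpose_mat (transpose_mat P * D)) (transpose_mat (transpose_mat P * D))"
    by (simp add: frob_inner_transpose)
  also have "\<dots> = frob_inner (transpose_mat X * (F * P)) (transpose_mat X * (F * P))"
    by (simp add: Dd(1) mat_dim_algebra F)
  also have "\<dots> = frob_inner (F * P) ((X * transpose_mat X) * (F * P))"
    by (simp add: frob_inner_mult_left mult_assoc_dim)
  also have "r ^ (j - 1) * \<dots> \<le> frob_inner (F * P) (R ^\<^sub>m ((j - 1) + N) * (F * P))"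
    unfolding XX by (rule low) simp_all
  also have "R ^\<^sub>m ((j - 1) + N) = X * (transpose_mat E * (E * transpose_mat X))"
    using balanced_mixed_gram[OF N W bal, of "j - 1"] j by (simp add: X_def E_def R_def add.commute)
  also have "frob_inner (F * P) (\<dots> * (F * P)) = frob_inner (E * (transpose_mat X * (F * P))) (E * (transpose_mat X * (F * P)))"
    by (simp add: frob_inner_mult_left[of E] frob_inner_mult_left[of "transpose_mat X"] mult_assoc_dim)
  also have "\<dots> = frob_inner (transpose_mat G) (transpose_mat G)"
    by (simp add: Dd mat_dim_algebra F)
  also have "\<dots> = frob_inner G G" by (rule frob_inner_transpose) auto
  finally show ?thesis .
qed

subsection \<open>The gradient of the network loss and its flow\<close>

lemma params_inner_eq_sum_frob_inner:
  assumes "G \<in> params N d"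
  shows "params_inner N d G H = (\<Sum>j\<in>{1..N}. frob_inner (G j) (H j))"
  unfolding params_inner_def frob_inner_def
proof (rule sum.cong)
  fix j assume "j \<in> {1..N}"
  then have "G j \<in> carrier_mat (d j) (d (j - 1))" using assms by (auto simp: params_def)
  then show "(\<Sum>a<d j. \<Sum>b<d (j - 1). G j $$ (a, b) * H j $$ (a, b)) =
      (\<Sum>i<dim_row (G j). \<Sum>ja<dim_col (G j). G j $$ (i, ja) * H j $$ (i, ja))" by auto
qed simp

lemma params_inner_self_nonneg: "0 \<le> params_inner N d G G"
  unfolding params_inner_def by (auto intro!: sum_nonneg)

text \<open>The function \<open>\<parallel>X - T X\<^sub>0\<parallel>\<^sup>2\<close> of the end-to-end matrix \<open>X\<close>, with \<open>T X\<^sub>0\<close> held fixed,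
  dominates the loss and agrees with it at \<open>X\<^sub>0\<close>; hence both have the same gradient there, and no
  derivative of a matrix square root is needed.\<close>

lemma net_loss_gradient:
  assumes dN: "d N = n" and S0: "pos_def n \<Sigma>\<^sub>0" and W: "W \<in> params N d"
    and grad: "has_gradient N d (net_loss N d \<Sigma>\<^sub>0) W G"
  defines "X \<equiv> end_to_end d W N"
  assumes T: "T \<in> carrier_mat n n"
    and TT: "(T * X) * transpose_mat (T * X) = \<Sigma>\<^sub>0"
    and L: "BW_loss \<Sigma>\<^sub>0 (X * transpose_mat X) = frob_inner (X - T * X) (X - T * X)"
    and j: "1 \<le> j" "j \<le> N"
  shows "G j = 2 \<cdot>\<^sub>m (transpose_mat (layer_prod d W j N) * (X - T * X) * transpose_mat (end_to_end d W (j - 1)))"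
proof -
  define P Q D where "P = layer_prod d W j N" and "Q = end_to_end d W (j - 1)" and "D = X - T * X"
  have jN: "j - 1 \<le> N" using j by simp
  have P: "P \<in> carrier_mat n (d j)" using layer_prod_carrier[OF W j(2)] dN by (simp add: P_def)
  have Q: "Q \<in> carrier_mat (d (j - 1)) (d 0)" using end_to_end_carrier[OF W jN] by (simp add: Q_def)
  have X: "X \<in> carrier_mat n (d 0)" using end_to_end_carrier[OF W, of N] dN by (simp add: X_def)
  have Gp: "G \<in> params N d" using grad by (simp add: has_gradient_def)
  have G: "G j \<in> carrier_mat (d j) (d (j - 1))" using params_carrier[OF Gp j] .
  note [simp] = carrier_matD[OF P] carrier_matD[OF Q] carrier_matD[OF X] carrier_matD[OF T] carrier_matD[OF G]
  have D: "D \<in> carrier_mat n (d 0)" by (auto simp: D_def intro!: carrier_matI)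
  note [simp] = carrier_matD[OF D]
  define M where "M = 2 \<cdot>\<^sub>m (transpose_mat P * D * transpose_mat Q)"
  have M: "M \<in> carrier_mat (d j) (d (j - 1))" by (auto simp: M_def intro!: carrier_matI)
  note [simp] = carrier_matD[OF M]
  \<comment> \<open>The test direction is the discrepancy itself. Along it the true slope
    \<open>frob_inner (G j) E\<close> exceeds the slope \<open>frob_inner M E\<close> of the
    dominating function by the squared norm of \<open>E\<close>, so one-sided domination already
    forces \<open>E\<close> to vanish.\<close>
  define E where "E = G j - M"
  have E: "E \<in> carrier_mat (d j) (d (j - 1))" by (auto simp: E_def intro!: carrier_matI)
  note [simp] = carrier_matD[OF E]
  define Z where "Z = P * E * Q"
  have Z: "Z \<in> carrier_mat n (d 0)" by (auto simp: Z_def intro!: carrier_matI)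
  note [simp] = carrier_matD[OF Z]
  have DZ: "2 * frob_inner D Z = frob_inner M E"
  proof -
    have "frob_inner D Z = frob_inner (P * (E * Q)) D"
      unfolding Z_def by (subst frob_inner_commute) (auto simp: mult_assoc_dim)
    also have "\<dots> = frob_inner E (transpose_mat P * D * transpose_mat Q)"
      by (subst frob_inner_mult_left) (auto simp: frob_inner_mult_right[of E Q])
    also have "\<dots> = frob_inner (transpose_mat P * D * transpose_mat Q) E"
      by (rule frob_inner_commute) auto
    finally show ?thesis by (simp add: M_def frob_inner_smult_left)
  qed
  have GE: "frob_inner (G j) E = frob_inner M E + frob_inner E E"
    by (subst (2) E_def) (simp add: frob_inner_minus_left)
  define H where "H s = (\<lambda>i. if i = j then s \<cdot>\<^sub>m E else 0\<^sub>m (d i) (d (i - 1)))" for s :: real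
  have H: "H s \<in> params N d" for s using E by (auto simp: H_def params_def)
  have inner_H: "params_inner N d A (H s) = s * frob_inner (A j) E" if A: "A \<in> params N d" for A s
  proof -
    have "params_inner N d A (H s) = (\<Sum>i\<in>{1..N}. if i = j then s * frob_inner (A j) E else 0)"
      unfolding params_inner_eq_sum_frob_inner[OF A]
    proof (rule sum.cong)
      fix i assume i: "i \<in> {1..N}"
      then have "A i \<in> carrier_mat (d i) (d (i - 1))" using A by (auto simp: params_def)
      then show "frob_inner (A i) (H s i) = (if i = j then s * frob_inner (A j) E else 0)"
        by (auto simp: H_def frob_inner_smult_right) (simp add: frob_inner_def)
    qed simp
    then show ?thesis using j by simp
  qed
  have norm_H: "params_norm N d (H s) = s * frob_norm E" if "0 \<le> s" for s
  proof -
    have "params_inner N d (H s) (H s) = (s * frob_norm E)\<^sup>2"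
      by (simp add: inner_H[OF H] power_mult_distrib frob_norm_sq)
        (simp add: H_def frob_inner_smult_left power2_eq_square)
    then show ?thesis using that frob_norm_nonneg[of E] by (simp add: params_norm_def)
  qed
  have fH: "net_loss N d \<Sigma>\<^sub>0 (\<lambda>i. W i + H s i) \<le>
      net_loss N d \<Sigma>\<^sub>0 W + s * frob_inner M E + s\<^sup>2 * frob_inner Z Z" for s
  proof -
    have sE: "s \<cdot>\<^sub>m E \<in> carrier_mat (d j) (d (j - 1))" using E by simp
    have "end_to_end d (\<lambda>i. W i + H s i) N = end_to_end d (W(j := W j + s \<cdot>\<^sub>m E)) N"
    proof (rule end_to_end_cong)
      fix i assume "1 \<le> i" "i \<le> N"
      then show "W i + H s i = (W(j := W j + s \<cdot>\<^sub>m E)) i"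
        using params_carrier[OF W, of i] by (auto simp: H_def)
    qed
    also have "\<dots> = X + P * (s \<cdot>\<^sub>m E) * Q"
      unfolding X_def P_def Q_def by (rule end_to_end_perturb_layer[OF W j le_refl sE])
    also have "P * (s \<cdot>\<^sub>m E) * Q = s \<cdot>\<^sub>m Z"
      using mult_smult_distrib[OF P E, of s] mult_smult_assoc_mat[of "P * E" n "d (j - 1)" Q "d 0" s] P E Q
      by (simp add: Z_def)
    finally have eq: "end_to_end d (\<lambda>i. W i + H s i) N = X + s \<cdot>\<^sub>m Z" .
    have c: "X + s \<cdot>\<^sub>m Z \<in> carrier_mat n (d 0)" "T * X \<in> carrier_mat n (d 0)"
      by (auto intro!: carrier_matI)
    have "net_loss N d \<Sigma>\<^sub>0 (\<lambda>i. W i + H s i) \<le> frob_inner (X + s \<cdot>\<^sub>m Z - T * X) (X + s \<cdot>\<^sub>m Z - T * X)"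
      unfolding net_loss_def end_cov_def eq by (rule BW_loss_le[OF S0 c TT])
    also have "X + s \<cdot>\<^sub>m Z - T * X = D + s \<cdot>\<^sub>m Z"
      by (rule eq_matI) (auto simp: D_def simp del: index_mult_mat(1))
    also have "frob_inner \<dots> \<dots> = frob_inner D D + s * (2 * frob_inner D Z) + s\<^sup>2 * frob_inner Z Z"
      by (simp add: frob_inner_add_left frob_inner_add_right frob_inner_smult_left frob_inner_smult_right
          frob_inner_commute[of Z D] power2_eq_square algebra_simps)
    also have "frob_inner D D = net_loss N d \<Sigma>\<^sub>0 W"
      using L by (simp add: net_loss_def end_cov_def X_def[symmetric] D_def)
    finally show ?thesis by (simp add: DZ)
  qed
  have "frob_norm E = 0"
  proof (rule ccontr)
    define \<eta> \<zeta> where "\<eta> = frob_norm E" and "\<zeta> = frob_inner Z Z"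
    assume "frob_norm E \<noteq> 0"
    then have \<eta>: "0 < \<eta>" using frob_norm_nonneg[of E] by (simp add: \<eta>_def)
    have \<zeta>: "0 \<le> \<zeta>" by (simp add: \<zeta>_def frob_inner_self_nonneg)
    from \<eta> have "0 < \<eta> / 2" by simp
    then obtain \<delta> where \<delta>: "0 < \<delta>" and fr: "\<And>H. H \<in> params N d \<Longrightarrow> params_norm N d H < \<delta> \<Longrightarrow>
        \<bar>net_loss N d \<Sigma>\<^sub>0 (\<lambda>j. W j + H j) - net_loss N d \<Sigma>\<^sub>0 W - params_inner N d G H\<bar> \<le> \<eta> / 2 * params_norm N d H"
      using grad unfolding has_gradient_def by blast
    \<comment> \<open>The first bound keeps the norm of the perturbation at most
      \<open>\<delta> / 2\<close>; the second makes the quadratic term \<open>s * \<zeta>\<close> at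
      most a quarter of the square of \<open>\<eta>\<close>, and \<open>\<zeta> + 1\<close> guards
      against \<open>\<zeta> = 0\<close>.\<close>
    define s where "s = min (\<delta> / (2 * \<eta>)) (\<eta>\<^sup>2 / (4 * (\<zeta> + 1)))"
    have s: "0 < s" using \<eta> \<zeta> \<delta> by (simp add: s_def)
    have "s * \<eta> \<le> \<delta> / (2 * \<eta>) * \<eta>" unfolding s_def using \<eta> by (intro mult_right_mono) auto
    then have "s * \<eta> < \<delta>" using \<eta> \<delta> by simp
    then have "\<bar>net_loss N d \<Sigma>\<^sub>0 (\<lambda>i. W i + H s i) - net_loss N d \<Sigma>\<^sub>0 W - params_inner N d G (H s)\<bar>
        \<le> \<eta> / 2 * (s * \<eta>)"
      using fr[OF H, of s] norm_H[of s] s by (simp add: \<eta>_def)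
    then have "s * frob_inner (G j) E \<le> \<eta> / 2 * (s * \<eta>) + s * frob_inner M E + s\<^sup>2 * \<zeta>"
      using fH[of s] unfolding inner_H[OF Gp] \<zeta>_def by linarith
    then have "s * (\<eta>\<^sup>2) \<le> s * (\<eta>\<^sup>2 / 2 + s * \<zeta>)"
      unfolding GE by (simp add: \<eta>_def frob_norm_sq[symmetric] algebra_simps power2_eq_square)
    then have "\<eta>\<^sup>2 \<le> \<eta>\<^sup>2 / 2 + s * \<zeta>" using s by simp
    moreover have "s * \<zeta> \<le> \<eta>\<^sup>2 / (4 * (\<zeta> + 1)) * \<zeta>" unfolding s_def using \<zeta> by (intro mult_right_mono) auto
    moreover have "\<eta>\<^sup>2 / (4 * (\<zeta> + 1)) * \<zeta> \<le> \<eta>\<^sup>2 / 4" using \<zeta> by (simp add: field_simps)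
    ultimately have "\<eta>\<^sup>2 \<le> 0" by linarith
    then show False using \<eta> by simp
  qed
  then have E0: "E = 0\<^sub>m (d j) (d (j - 1))" using frob_inner_self_eq_0[of E] by (simp flip: frob_norm_sq)
  have "G j = M"
  proof (rule eq_matI)
    fix a b assume "a < dim_row M" "b < dim_col M"
    then show "G j $$ (a, b) = M $$ (a, b)" using arg_cong[OF E0, of "\<lambda>A. A $$ (a, b)"] by (simp add: E_def)
  qed auto
  then show ?thesis by (simp add: M_def P_def Q_def D_def)
qed

section \<open>Chain rule, differential inequalities and the conservation law on the
  half-line\<close>

lemma gradient_flow_deriv_loss:
  fixes W :: "real \<Rightarrow> nat \<Rightarrow> real mat"
  assumes f: "\<And>V V'. (\<And>j. 1 \<le> j \<Longrightarrow> j \<le> N \<Longrightarrow> V j = V' j) \<Longrightarrow> f V = f V'"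
    and Wp: "\<And>s. 0 \<le> s \<Longrightarrow> W s \<in> params N d" and t: "0 \<le> t"
    and grad: "has_gradient N d f (W t) G"
    and W': "\<And>j a b. 1 \<le> j \<Longrightarrow> j \<le> N \<Longrightarrow> a < d j \<Longrightarrow> b < d (j - 1) \<Longrightarrow>
      ((\<lambda>s. W s j $$ (a, b)) has_real_derivative - (G j $$ (a, b))) (at t within {0..})"
  shows "((\<lambda>s. f (W s)) has_real_derivative - params_inner N d G G) (at t within {0..})"
proof -
  let ?F = "at t within {0..}"
  define H where "H s = (\<lambda>j. W s j - W t j)" for s
  define q where "q s j a b = (W s j $$ (a, b) - W t j $$ (a, b)) / (s - t)" for s j a b
  have Hp: "H s \<in> params N d" if "0 \<le> s" for s using Wp[OF that] Wp[OF t] by (auto simp: H_def params_def intro!: minus_carrier_mat)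
  have H_entry: "H s j $$ (a, b) = (s - t) * q s j a b" if "s \<noteq> t" "j \<in> {1..N}" "a < d j" "b < d (j - 1)" for s j a b
    using that params_carrier[OF Wp[OF t], of j] by (auto simp: H_def q_def)
  have q: "((\<lambda>s. q s j a b) \<longlongrightarrow> - (G j $$ (a, b))) ?F" if "j \<in> {1..N}" "a < d j" "b < d (j - 1)" for j a b
    using W'[of j a b] that by (simp add: has_field_derivative_iff q_def)
  \<comment> \<open>These are the inner product with \<open>G\<close> and the norm of the difference
    quotient of the trajectory. Convergence of \<open>v\<close> keeps that quotient bounded, which
    turns the Frechet remainder into one of order \<open>o(s - t)\<close>.\<close>
  define u v where "u s = (\<Sum>j\<in>{1..N}. \<Sum>a<d j. \<Sum>b<d (j - 1). G j $$ (a, b) * q s j a b)"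
    and "v s = sqrt (\<Sum>j\<in>{1..N}. \<Sum>a<d j. \<Sum>b<d (j - 1). q s j a b * q s j a b)" for s
  define g where "g = params_norm N d G"
  have g: "0 \<le> g" by (simp add: g_def params_norm_def params_inner_self_nonneg)
  have "(u \<longlongrightarrow> (\<Sum>j\<in>{1..N}. \<Sum>a<d j. \<Sum>b<d (j - 1). G j $$ (a, b) * - (G j $$ (a, b)))) ?F"
    unfolding u_def by (intro tendsto_sum tendsto_mult tendsto_const q) auto
  then have u: "(u \<longlongrightarrow> - params_inner N d G G) ?F"
    by (simp add: params_inner_def sum_negf)
  have "(v \<longlongrightarrow> sqrt (\<Sum>j\<in>{1..N}. \<Sum>a<d j. \<Sum>b<d (j - 1). - (G j $$ (a, b)) * - (G j $$ (a, b)))) ?F"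
    unfolding v_def by (intro tendsto_real_sqrt tendsto_sum tendsto_mult q) auto
  then have v: "(v \<longlongrightarrow> g) ?F" by (simp add: params_inner_def params_norm_def g_def)
  have inner: "params_inner N d G (H s) = (s - t) * u s" if "s \<noteq> t" for s
    unfolding params_inner_def u_def sum_distrib_left using that
    by (intro sum.cong refl) (auto simp: H_entry)
  have norm: "params_norm N d (H s) = \<bar>s - t\<bar> * v s" if "s \<noteq> t" for s
  proof -
    have "params_inner N d (H s) (H s) = (s - t)\<^sup>2 * (\<Sum>j\<in>{1..N}. \<Sum>a<d j. \<Sum>b<d (j - 1). q s j a b * q s j a b)"
      unfolding params_inner_def sum_distrib_left using that
      by (intro sum.cong refl) (auto simp: H_entry power2_eq_square)
    then show ?thesis by (simp add: params_norm_def v_def real_sqrt_mult)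
  qed
  \<comment> \<open>Outside the layers \<open>1, ..., N\<close> the shapes are unconstrained and
    adding the difference back may fail to return \<open>W s j\<close>; this is where
    \<open>f\<close> must depend on those layers alone.\<close>
  have fH: "f (\<lambda>j. W t j + H s j) = f (W s)" if s: "0 \<le> s" for s
  proof (rule f)
    fix j assume "1 \<le> j" "j \<le> N"
    then show "W t j + H s j = W s j"
      using params_carrier[OF Wp[OF s], of j] params_carrier[OF Wp[OF t], of j]
      by (intro eq_matI) (auto simp: H_def)
  qed
  have rem: "((\<lambda>s. (f (W s) - f (W t)) / (s - t) - u s) \<longlongrightarrow> 0) ?F"
  proof (rule tendstoI)
    fix e :: real assume e: "0 < e"
    \<comment> \<open>Near \<open>t\<close> one has \<open>v s < g + 1\<close>, so the error is at
      most \<open>e / 2\<close>; the summand 1 also covers critical points, where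
      \<open>g = 0\<close>.\<close>
    define \<epsilon> where "\<epsilon> = e / (2 * (g + 1))"
    have \<epsilon>: "0 < \<epsilon>" using e g by (simp add: \<epsilon>_def)
    then obtain \<delta> where \<delta>: "0 < \<delta>" and fr: "\<And>H. H \<in> params N d \<Longrightarrow> params_norm N d H < \<delta> \<Longrightarrow>
        \<bar>f (\<lambda>j. W t j + H j) - f (W t) - params_inner N d G H\<bar> \<le> \<epsilon> * params_norm N d H"
      using grad unfolding has_gradient_def by blast
    have "((\<lambda>s. \<bar>s - t\<bar> * v s) \<longlongrightarrow> \<bar>t - t\<bar> * g) ?F" by (intro tendsto_intros v)
    then have "\<forall>\<^sub>F s in ?F. \<bar>s - t\<bar> * v s < \<delta>" using \<delta> by (intro order_tendstoD(2)) auto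
    moreover have "\<forall>\<^sub>F s in ?F. v s < g + 1" using v by (intro order_tendstoD(2)) auto
    moreover have "\<forall>\<^sub>F s in ?F. s \<noteq> t \<and> 0 \<le> s" by (auto simp: eventually_at_filter)
    ultimately show "\<forall>\<^sub>F s in ?F. dist ((f (W s) - f (W t)) / (s - t) - u s) 0 < e"
    proof eventually_elim
      case (elim s)
      then have st: "s \<noteq> t" "0 \<le> s" by auto
      have "\<bar>f (W s) - f (W t) - (s - t) * u s\<bar> \<le> \<epsilon> * (\<bar>s - t\<bar> * v s)"
        using fr[OF Hp[OF st(2)]] elim(1) by (simp add: norm[OF st(1)] inner[OF st(1)] fH[OF st(2)])
      moreover have "(f (W s) - f (W t)) / (s - t) - u s = (f (W s) - f (W t) - (s - t) * u s) / (s - t)"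
        using st by (simp add: field_simps)
      ultimately have "\<bar>(f (W s) - f (W t)) / (s - t) - u s\<bar> \<le> \<epsilon> * v s"
        using st by (simp add: abs_divide divide_le_eq algebra_simps)
      also have "\<dots> \<le> \<epsilon> * (g + 1)" using \<epsilon> elim by (intro mult_left_mono) auto
      also have "\<dots> < e" using e g by (simp add: \<epsilon>_def field_simps add_pos_nonneg)
      finally show ?case by simp
    qed
  qed
  show ?thesis
    unfolding has_field_derivative_iff using tendsto_add[OF rem u] by simp
qed

text \<open>At the end point 0 the one-sided derivative is used only for continuity; at interior
  points it is an ordinary derivative.\<close>

lemma deriv_nonpos_imp_le_initial:
  fixes g :: "real \<Rightarrow> real"
  assumes g': "\<And>s. 0 \<le> s \<Longrightarrow> (g has_real_derivative g' s) (at s within {0..})"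
    and nonpos: "\<And>s. 0 \<le> s \<Longrightarrow> g' s \<le> 0" and t: "0 \<le> t"
  shows "g t \<le> g 0"
  using t
proof (rule DERIV_nonpos_imp_decreasing_open[where f = g])
  fix s assume s: "0 < s" "s < t"
  have "(g has_real_derivative g' s) (at s within {0<..})"
    using s by (intro DERIV_subset[OF g']) auto
  then show "\<exists>y. DERIV g s :> y \<and> y \<le> 0"
    using at_within_open[of s "{0<..}"] nonpos[of s] s by auto
next
  have "continuous_on {0..} g" by (rule DERIV_continuous_on) (use g' in auto)
  then show "continuous_on {0..t} g" by (rule continuous_on_subset) auto
qed

lemma deriv_zero_imp_eq_initial:
  fixes g :: "real \<Rightarrow> real"
  assumes g': "\<And>s. 0 \<le> s \<Longrightarrow> (g has_real_derivative 0) (at s within {0..})" and t: "0 \<le> t"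
  shows "g t = g 0"
proof (rule antisym)
  show "g t \<le> g 0" by (rule deriv_nonpos_imp_le_initial[OF g' _ t]) auto
  have "- g t \<le> - g 0"
    by (rule deriv_nonpos_imp_le_initial[where g' = "\<lambda>_. 0", OF _ _ t]) (use DERIV_minus[OF g'] in auto)
  then show "g 0 \<le> g t" by simp
qed

text \<open>Gronwall's argument: the integrating factor \<open>exp (k * s)\<close> makes the product
  nonincreasing.\<close>

lemma exponential_decay:
  fixes g :: "real \<Rightarrow> real"
  assumes g': "\<And>s. 0 \<le> s \<Longrightarrow> (g has_real_derivative g' s) (at s within {0..})"
    and le: "\<And>s. 0 \<le> s \<Longrightarrow> g' s \<le> - k * g s" and t: "0 \<le> t"
  shows "g t \<le> exp (- k * t) * g 0"
proof -
  have "exp (k * t) * g t \<le> exp (k * 0) * g 0"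
  proof (rule deriv_nonpos_imp_le_initial[OF _ _ t])
    fix s :: real assume s: "0 \<le> s"
    show "((\<lambda>s. exp (k * s) * g s) has_real_derivative exp (k * s) * (k * g s + g' s)) (at s within {0..})"
      by (auto intro!: derivative_eq_intros g'[OF s] simp: algebra_simps)
    show "exp (k * s) * (k * g s + g' s) \<le> 0"
      using le[OF s] by (simp add: mult_le_0_iff)
  qed
  then have "exp (- k * t) * (exp (k * t) * g t) \<le> exp (- k * t) * g 0"
    by (intro mult_left_mono) auto
  moreover have "exp (- k * t) * exp (k * t) = 1" by (simp flip: exp_add)
  ultimately show ?thesis by (simp only: mult.assoc[symmetric] mult_1_left)
qed

text \<open>The two Gram matrices in a balance equation have derivatives
  \<open>- (G W^T + W G^T)\<close> for layer \<open>j\<close> and \<open>- (W^T G + G^T W)\<close>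
  for layer \<open>j + 1\<close>. The premise \<open>GW\<close> and its transpose equate them, so
  every entry of the difference is constant.\<close>

lemma balanced_preserved:
  fixes W :: "real \<Rightarrow> nat \<Rightarrow> real mat"
  assumes bal: "balanced N (W 0)" and Wp: "\<And>s. 0 \<le> s \<Longrightarrow> W s \<in> params N d"
    and Gp: "\<And>s. 0 \<le> s \<Longrightarrow> G s \<in> params N d"
    and W': "\<And>s j a b. 0 \<le> s \<Longrightarrow> 1 \<le> j \<Longrightarrow> j \<le> N \<Longrightarrow> a < d j \<Longrightarrow> b < d (j - 1) \<Longrightarrow>
      ((\<lambda>s. W s j $$ (a, b)) has_real_derivative - (G s j $$ (a, b))) (at s within {0..})"
    and GW: "\<And>s j. 0 \<le> s \<Longrightarrow> 1 \<le> j \<Longrightarrow> j < N \<Longrightarrow>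
      G s j * transpose_mat (W s j) = transpose_mat (W s (j + 1)) * G s (j + 1)"
    and t: "0 \<le> t"
  shows "balanced N (W t)"
  unfolding balanced_def
proof (intro ballI)
  fix j assume "j \<in> {1..<N}"
  then have j: "1 \<le> j" "j < N" "j \<le> N" "1 \<le> j + 1" "j + 1 \<le> N" by auto
  have c: "W s j \<in> carrier_mat (d j) (d (j - 1))" "W s (j + 1) \<in> carrier_mat (d (j + 1)) (d j)"
    "G s j \<in> carrier_mat (d j) (d (j - 1))" "G s (j + 1) \<in> carrier_mat (d (j + 1)) (d j)" if "0 \<le> s" for s
    using params_carrier[OF Wp[OF that]] params_carrier[OF Gp[OF that]] j
    by (metis add_diff_cancel_right')+
  have W1: "(W s j * transpose_mat (W s j)) $$ (a, b) = (\<Sum>k<d (j - 1). W s j $$ (a, k) * W s j $$ (b, k))"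
    if "a < d j" "b < d j" "0 \<le> s" for s a b
    using that c(1)[of s] by (subst index_mult_mat_sum) auto
  have W2: "(transpose_mat (W s (j + 1)) * W s (j + 1)) $$ (a, b) = (\<Sum>k<d (j + 1). W s (j + 1) $$ (k, a) * W s (j + 1) $$ (k, b))"
    if "a < d j" "b < d j" "0 \<le> s" for s a b
    using that c(2)[of s] by (subst index_mult_mat_sum) auto
  show "W t j * transpose_mat (W t j) = transpose_mat (W t (j + 1)) * W t (j + 1)"
  proof (rule eq_matI)
    fix a b assume "a < dim_row (transpose_mat (W t (j + 1)) * W t (j + 1))"
      "b < dim_col (transpose_mat (W t (j + 1)) * W t (j + 1))"
    then have ab: "a < d j" "b < d j" using c(2)[OF t] by auto
    define g where "g s = (\<Sum>k<d (j - 1). W s j $$ (a, k) * W s j $$ (b, k))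
      - (\<Sum>k<d (j + 1). W s (j + 1) $$ (k, a) * W s (j + 1) $$ (k, b))" for s
    have "g t = g 0"
    proof (rule deriv_zero_imp_eq_initial[OF _ t])
      fix s :: real assume s: "0 \<le> s"
      note cs = c[OF s]
      have GW': "(\<Sum>k<d (j - 1). G s j $$ (x, k) * W s j $$ (y, k)) =
          (\<Sum>k<d (j + 1). W s (j + 1) $$ (k, x) * G s (j + 1) $$ (k, y))" if "x < d j" "y < d j" for x y
      proof -
        have "(\<Sum>k<d (j - 1). G s j $$ (x, k) * W s j $$ (y, k)) = (G s j * transpose_mat (W s j)) $$ (x, y)"
          using that cs by (subst index_mult_mat_sum) auto
        also have "\<dots> = (transpose_mat (W s (j + 1)) * G s (j + 1)) $$ (x, y)"
          by (simp only: GW[OF s j(1,2)])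
        also have "\<dots> = (\<Sum>k<d (j + 1). W s (j + 1) $$ (k, x) * G s (j + 1) $$ (k, y))"
          using that cs by (subst index_mult_mat_sum) auto
        finally show ?thesis .
      qed
      have "(g has_real_derivative
          (\<Sum>k<d (j - 1). - (G s j $$ (a, k)) * W s j $$ (b, k) + - (G s j $$ (b, k)) * W s j $$ (a, k))
          - (\<Sum>k<d (j + 1). - (G s (j + 1) $$ (k, a)) * W s (j + 1) $$ (k, b)
              + - (G s (j + 1) $$ (k, b)) * W s (j + 1) $$ (k, a))) (at s within {0..})"
        unfolding g_def using ab j s by (intro DERIV_diff DERIV_sum DERIV_mult W') auto
      also have "(\<Sum>k<d (j - 1). - (G s j $$ (a, k)) * W s j $$ (b, k) + - (G s j $$ (b, k)) * W s j $$ (a, k))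
          = - (\<Sum>k<d (j - 1). G s j $$ (a, k) * W s j $$ (b, k)) - (\<Sum>k<d (j - 1). G s j $$ (b, k) * W s j $$ (a, k))"
        by (simp add: sum.distrib sum_negf sum_subtractf)
      also have "(\<Sum>k<d (j + 1). - (G s (j + 1) $$ (k, a)) * W s (j + 1) $$ (k, b)
              + - (G s (j + 1) $$ (k, b)) * W s (j + 1) $$ (k, a)) =
          - (\<Sum>k<d (j + 1). W s (j + 1) $$ (k, b) * G s (j + 1) $$ (k, a))
          - (\<Sum>k<d (j + 1). W s (j + 1) $$ (k, a) * G s (j + 1) $$ (k, b))"
        by (simp add: sum.distrib sum_negf sum_subtractf mult.commute)
      \<comment> \<open>The identity enters at \<open>(a, b)\<close> and at \<open>(b, a)\<close>,
        the latter for the transposed terms of the product rule.\<close>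
      finally show "(g has_real_derivative 0) (at s within {0..})"
        unfolding GW'[OF ab] GW'[OF ab(2) ab(1)] by simp
    qed
    moreover have "g 0 = 0"
      using bal j W1[OF ab, of 0] W2[OF ab, of 0] by (simp add: g_def balanced_def)
    ultimately show "(W t j * transpose_mat (W t j)) $$ (a, b) = (transpose_mat (W t (j + 1)) * W t (j + 1)) $$ (a, b)"
      unfolding W1[OF ab t] W2[OF ab t] by (simp add: g_def)
  qed (use c[OF t] in auto)
qed

text \<open>For orthogonal \<open>U\<close> the matrix \<open>A * U\<close> is a factor of
  \<open>\<Sigma>\<^sub>0\<close>, so the root of the loss is a lower bound for all the distances
  and hence for their infimum. As this root is nonnegative, the margin also gives the bound on
  \<open>c\<close>.\<close>

lemma margin_imp_BW_loss_le:
  assumes S0: "pos_def n \<Sigma>\<^sub>0" and n: "0 < n" and margin: "modified_deficiency_margin n \<Sigma>\<^sub>0 \<Sigma> c"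
  shows "c \<le> sqrt (lambda_min \<Sigma>\<^sub>0)" "BW_loss \<Sigma>\<^sub>0 \<Sigma> \<le> (sqrt (lambda_min \<Sigma>\<^sub>0) - c)\<^sup>2"
proof -
  have S0': "psd n \<Sigma>\<^sub>0" using S0 by (rule pos_def_imp_psd)
  define A B where "A = mat_sqrt \<Sigma>\<^sub>0" and "B = mat_sqrt \<Sigma>"
  have S: "psd n \<Sigma>" using margin by (simp add: modified_deficiency_margin_def)
  have A: "A \<in> carrier_mat n n" "transpose_mat A = A" "A * A = \<Sigma>\<^sub>0"
    using mat_sqrt_psd[OF S0'] by (auto simp: A_def psd_def)
  have B: "B \<in> carrier_mat n n" "B * transpose_mat B = \<Sigma>"
    using mat_sqrt_psd[OF S] by (auto simp: B_def psd_def)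
  have L0: "0 \<le> BW_loss \<Sigma>\<^sub>0 \<Sigma>" using BW_loss_nonneg[OF S0' B(1)] by (simp add: B(2))
  have "sqrt (BW_loss \<Sigma>\<^sub>0 \<Sigma>) \<le> (INF U\<in>orth_group n. frob_norm (B - A * U))"
  proof (rule cINF_greatest)
    have "1\<^sub>m n \<in> orth_group n" by (simp add: orth_group_def)
    then show "orth_group n \<noteq> {}" by blast
    fix U assume "U \<in> orth_group n"
    then have U: "U \<in> carrier_mat n n" "U * transpose_mat U = 1\<^sub>m n" by (auto simp: orth_group_def)
    note [simp] = carrier_matD[OF A(1)] carrier_matD[OF U(1)]
    have AU: "A * U \<in> carrier_mat n n" by (auto intro!: carrier_matI)
    have "(A * U) * transpose_mat (A * U) = A * ((U * transpose_mat U) * A)" by (simp add: mat_dim_algebra A(2))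
    also have "\<dots> = \<Sigma>\<^sub>0" by (simp add: U(2) left_mult_one_dim A(3))
    finally have "BW_loss \<Sigma>\<^sub>0 (B * transpose_mat B) \<le> frob_inner (B - A * U) (B - A * U)"
      by (rule BW_loss_le[OF S0 B(1) AU])
    then have "BW_loss \<Sigma>\<^sub>0 \<Sigma> \<le> (frob_norm (B - A * U))\<^sup>2" by (simp add: B(2) frob_norm_sq)
    then show "sqrt (BW_loss \<Sigma>\<^sub>0 \<Sigma>) \<le> frob_norm (B - A * U)"
      using frob_norm_nonneg by (intro real_le_lsqrt) auto
  qed
  also have "\<dots> \<le> sqrt (lambda_min \<Sigma>\<^sub>0) - c"
    using margin sigma_min_mat_sqrt[OF S0' n] by (simp add: modified_deficiency_margin_def A_def B_def)
  finally have *: "sqrt (BW_loss \<Sigma>\<^sub>0 \<Sigma>) \<le> sqrt (lambda_min \<Sigma>\<^sub>0) - c" .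
  have "0 \<le> sqrt (BW_loss \<Sigma>\<^sub>0 \<Sigma>)" using L0 by simp
  then show "c \<le> sqrt (lambda_min \<Sigma>\<^sub>0)" using * by linarith
  show "BW_loss \<Sigma>\<^sub>0 \<Sigma> \<le> (sqrt (lambda_min \<Sigma>\<^sub>0) - c)\<^sup>2"
    using power_mono[OF * \<open>0 \<le> sqrt (BW_loss \<Sigma>\<^sub>0 \<Sigma>)\<close>, of 2] L0 by simp
qed

section \<open>Comparison of the claimed rate with the rate obtained\<close>

lemma lambda_min_le_trace:
  assumes S: "psd n S" and n: "0 < n"
  shows "lambda_min S \<le> mat_trace S"
proof -
  have c: "S \<in> carrier_mat n n" "transpose_mat S = S" using S by (auto simp: psd_def)
  have "lambda_min S \<le> lambda_min S * real n"
    using mult_left_mono[of 1 "real n" "lambda_min S"] lambda_min_nonneg[OF S n] n by simp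
  also have "real n = frob_inner (1\<^sub>m n) (1\<^sub>m n)"
    using mat_trace_mult_transpose[of "1\<^sub>m n" "1\<^sub>m n"] by (simp add: mat_trace_def)
  also have "lambda_min S * \<dots> \<le> frob_inner (1\<^sub>m n) (S * 1\<^sub>m n)"
    by (rule lambda_min_le_frob_inner[OF c]) simp
  also have "\<dots> = mat_trace S"
    using mat_trace_mult_transpose[of "1\<^sub>m n" S] c by (simp add: left_mult_one_dim right_mult_one_dim)
  finally show ?thesis .
qed

text \<open>The exponent equals \<open>2 (N - 1) / N + 2\<close>, so the quotient of the two rates
  is \<open>2 c^2 K = c^3 s / C^2\<close>. This is at most \<open>s^4 / C^2\<close>, hence at most
  1.\<close>

lemma decay_rate_le:
  fixes c s C :: real
  assumes N: "1 \<le> N" and c: "0 < c" "c \<le> s" and C: "s\<^sup>2 \<le> C" and K: "K = sqrt (c\<^sup>2 * s\<^sup>2) / (2 * C\<^sup>2)"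
  shows "8 * real N * c powr (2 * (2 * real N - 1) / real N) * K \<le> 4 * real N * (c powr (2 / real N)) ^ (N - 1)"
proof -
  define r where "r = (c powr (2 / real N)) ^ (N - 1)"
  have r: "r = c powr (2 / real N * (real N - 1))"
    using c N by (simp add: r_def powr_powr of_nat_diff flip: powr_realpow)
  have "2 * (2 * real N - 1) / real N = 2 / real N * (real N - 1) + 2" using N by (simp add: field_simps)
  then have p: "c powr (2 * (2 * real N - 1) / real N) = r * c\<^sup>2"
    using c by (simp add: r powr_add powr_numeral)
  have r0: "0 < r" using c by (simp add: r)
  have C0: "0 < C" using c C by (meson less_le_trans zero_less_power)
  have "c ^ 3 * s \<le> s ^ 3 * s" using c by (intro mult_right_mono power_mono) auto
  also have "\<dots> = (s\<^sup>2)\<^sup>2" by (simp add: power2_eq_square power3_eq_cube)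
  also have "\<dots> \<le> C\<^sup>2" using C by (intro power_mono) auto
  finally have cs: "c ^ 3 * s / C\<^sup>2 \<le> 1" using C0 by simp
  have K': "K = c * s / (2 * C\<^sup>2)" using c by (simp add: K real_sqrt_mult)
  have "8 * real N * (r * c\<^sup>2) * K = 4 * real N * r * (c ^ 3 * s / C\<^sup>2)"
    by (simp add: K' power2_eq_square power3_eq_cube)
  also have "\<dots> \<le> 4 * real N * r * 1" using cs r0 by (intro mult_left_mono) auto
  finally show ?thesis unfolding p r_def by simp
qed

theorem theoremE15:
  fixes N m n :: nat and d :: "nat \<Rightarrow> nat"
    and \<Sigma>\<^sub>0 \<Sigma>star :: "real mat"
    and W :: "real \<Rightarrow> nat \<Rightarrow> real mat"
    and \<Sigma> :: "real \<Rightarrow> real mat"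
    and c K C :: real
  assumes depth: "1 \<le> N"
    and widths: "d 0 = m" "d N = n" "\<forall>j\<le>N. 1 \<le> d j"
    and Sigma0: "pos_def n \<Sigma>\<^sub>0"
    and Sigma_star: "\<Sigma>star = \<Sigma>\<^sub>0" "is_arg_min (BW_loss \<Sigma>\<^sub>0) (psd n) \<Sigma>star"
    and flow: "gradient_flow N d (net_loss N d \<Sigma>\<^sub>0) W"
    and Sigma: "\<And>t. \<Sigma> t = end_cov N d (W t)"
    and balanced: "balanced N (W 0)"
    and margin: "modified_deficiency_margin n \<Sigma>\<^sub>0 (\<Sigma> 0) c"
    and C: "C = 2 * (BW_loss \<Sigma>\<^sub>0 (\<Sigma> 0) + mat_trace \<Sigma>\<^sub>0)"
    and K: "K = sqrt (c\<^sup>2 * lambda_min \<Sigma>\<^sub>0) / (2 * C\<^sup>2)"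
  shows "\<forall>t\<ge>0. BW_loss \<Sigma>\<^sub>0 (\<Sigma> t) - BW_loss \<Sigma>\<^sub>0 \<Sigma>star
    \<le> exp (- (8 * real N * c powr (2 * (2 * real N - 1) / real N) * K * t))
       * (BW_loss \<Sigma>\<^sub>0 (\<Sigma> 0) - BW_loss \<Sigma>\<^sub>0 \<Sigma>star)"
proof -
  define f where "f = net_loss N d \<Sigma>\<^sub>0"
  define \<sigma> where "\<sigma> = sqrt (lambda_min \<Sigma>\<^sub>0)"
  \<comment> \<open>A lower bound for the eigenvalues of \<open>W N * transpose_mat (W N)\<close>:
    their \<open>N\<close>-th powers are squared singular values of the end-to-end matrix, at least
    the square of \<open>c\<close>.\<close>
  define r where "r = c powr (2 / real N)"
  define X where "X t = end_to_end d (W t) N" for t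
  have n: "0 < n" using widths(2) widths(3)[rule_format, of N] by simp
  have c0: "0 < c" using margin by (simp add: modified_deficiency_margin_def)
  have S0: "psd n \<Sigma>\<^sub>0" by (rule pos_def_imp_psd[OF Sigma0])
  have S0c: "\<Sigma>\<^sub>0 \<in> carrier_mat n n" "transpose_mat \<Sigma>\<^sub>0 = \<Sigma>\<^sub>0" using S0 by (auto simp: psd_def)
  have \<sigma>2: "\<sigma>\<^sup>2 = lambda_min \<Sigma>\<^sub>0" using lambda_min_nonneg[OF S0 n] by (simp add: \<sigma>_def)
  have cs: "c \<le> \<sigma>" and L0: "BW_loss \<Sigma>\<^sub>0 (\<Sigma> 0) \<le> (\<sigma> - c)\<^sup>2"
    using margin_imp_BW_loss_le[OF Sigma0 n margin] by (simp_all add: \<sigma>_def)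
  have \<Sigma>X: "\<Sigma> t = X t * transpose_mat (X t)" for t by (simp add: Sigma end_cov_def X_def)
  have fX: "f (W t) = BW_loss \<Sigma>\<^sub>0 (X t * transpose_mat (X t))" for t
    by (simp add: f_def net_loss_def end_cov_def X_def)
  have f_cong: "f V = f V'" if "\<And>j. 1 \<le> j \<Longrightarrow> j \<le> N \<Longrightarrow> V j = V' j" for V V'
    using end_to_end_cong[of N V V' d] that by (simp add: f_def net_loss_def end_cov_def)
  have "\<forall>t\<in>{0..}. \<exists>G. W t \<in> params N d \<and> has_gradient N d f (W t) G \<and>
      (\<forall>j\<in>{1..N}. \<forall>a<d j. \<forall>b<d (j - 1).
         ((\<lambda>s. W s j $$ (a, b)) has_real_derivative - (G j $$ (a, b))) (at t within {0..}))"
    using flow unfolding gradient_flow_def f_def by auto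
  then obtain G where G: "\<forall>t\<in>{0..}. W t \<in> params N d \<and> has_gradient N d f (W t) (G t) \<and>
      (\<forall>j\<in>{1..N}. \<forall>a<d j. \<forall>b<d (j - 1).
         ((\<lambda>s. W s j $$ (a, b)) has_real_derivative - (G t j $$ (a, b))) (at t within {0..}))"
    by (rule bchoice[THEN exE])
  have Wp: "W t \<in> params N d" and grad: "has_gradient N d f (W t) (G t)" if "0 \<le> t" for t
    using G that by auto
  have W': "((\<lambda>s. W s j $$ (a, b)) has_real_derivative - (G t j $$ (a, b))) (at t within {0..})"
    if "0 \<le> t" "1 \<le> j" "j \<le> N" "a < d j" "b < d (j - 1)" for t j a b
    using G that by auto
  have Gp: "G t \<in> params N d" if "0 \<le> t" for t using grad[OF that] by (simp add: has_gradient_def)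
  have Xc: "X t \<in> carrier_mat n m" if "0 \<le> t" for t
    using end_to_end_carrier[OF Wp[OF that], of N] widths by (simp add: X_def)
  have f': "((\<lambda>s. f (W s)) has_real_derivative - params_inner N d (G t) (G t)) (at t within {0..})" if "0 \<le> t" for t
    by (rule gradient_flow_deriv_loss[OF f_cong Wp that grad[OF that] W'[OF that]])
  have dec: "f (W t) \<le> f (W 0)" if "0 \<le> t" for t
    by (rule deriv_nonpos_imp_le_initial[OF f' _ that]) (auto simp: params_inner_self_nonneg)
  have sing: "c\<^sup>2 * frob_inner Y Y \<le> frob_inner (transpose_mat (X t) * Y) (transpose_mat (X t) * Y)"
    if t: "0 \<le> t" and Y: "dim_row Y = n" for t Y
  proof (rule BW_loss_le_imp_singular_value_bound[OF S0 Xc[OF t] Y])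
    show "\<sigma>\<^sup>2 * frob_inner Y Y \<le> frob_inner Y (\<Sigma>\<^sub>0 * Y)"
      unfolding \<sigma>2 by (rule lambda_min_le_frob_inner[OF S0c Y])
    show "BW_loss \<Sigma>\<^sub>0 (X t * transpose_mat (X t)) \<le> (\<sigma> - c)\<^sup>2"
      using dec[OF t] L0 by (simp add: fX \<Sigma>X)
  qed (use c0 cs in auto)
  \<comment> \<open>The factor is chosen separately at each time. It stays frozen while the gradient
    at that time is computed, so its regularity in \<open>t\<close> never enters.\<close>
  have "\<exists>T. T \<in> carrier_mat n n \<and> transpose_mat T = T \<and> (T * X t) * transpose_mat (T * X t) = \<Sigma>\<^sub>0
      \<and> f (W t) = frob_inner (X t - T * X t) (X t - T * X t)" if "0 \<le> t" for t
    using BW_loss_optimal_factor[OF Sigma0 Xc[OF that] c0 sing[OF that]] unfolding fX by metis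
  then obtain T where T: "T t \<in> carrier_mat n n" "transpose_mat (T t) = T t"
      "(T t * X t) * transpose_mat (T t * X t) = \<Sigma>\<^sub>0"
      "f (W t) = frob_inner (X t - T t * X t) (X t - T t * X t)" if "0 \<le> t" for t
    by metis
  define D where "D t = X t - T t * X t" for t
  have Dc: "D t \<in> carrier_mat n m" if "0 \<le> t" for t
    using Xc[OF that] T(1)[OF that] by (auto simp: D_def intro!: carrier_matI)
  have Gj: "G t j = 2 \<cdot>\<^sub>m (transpose_mat (layer_prod d (W t) j N) * D t * transpose_mat (end_to_end d (W t) (j - 1)))"
    if t: "0 \<le> t" and j: "1 \<le> j" "j \<le> N" for t j
    using net_loss_gradient[OF widths(2) Sigma0 Wp[OF t] grad[OF t, unfolded f_def] T(1)[OF t] _ _ j]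
      T(3,4)[OF t] by (simp add: X_def D_def fX[unfolded X_def])
  \<comment> \<open>With \<open>P\<close> the product above layer \<open>j + 1\<close> and
    \<open>E\<close> the product below layer \<open>j\<close>, both sides of the required identity
    are twice \<open>W (j + 1)^T P^T D E^T (W j)^T\<close>.\<close>
  have bal: "balanced N (W t)" if t: "0 \<le> t" for t
  proof (rule balanced_preserved[OF balanced Wp Gp W' _ t])
    fix s :: real and j assume s: "0 \<le> s" and j: "1 \<le> j" "j < N"
    note w = Wp[OF s]
    define P E where "P = layer_prod d (W s) (j + 1) N" and "E = end_to_end d (W s) (j - 1)"
    have P: "P \<in> carrier_mat n (d (j + 1))" using layer_prod_carrier[OF w, of "j + 1" N] j widths by (simp add: P_def)
    have jN: "j - 1 \<le> N" using j by simp
    have E: "E \<in> carrier_mat (d (j - 1)) m" using end_to_end_carrier[OF w jN] widths by (simp add: E_def)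
    have Wj: "W s j \<in> carrier_mat (d j) (d (j - 1))" "W s (j + 1) \<in> carrier_mat (d (j + 1)) (d j)"
      using params_carrier[OF w, of j] params_carrier[OF w, of "j + 1"] j by auto
    note [simp] = carrier_matD[OF P] carrier_matD[OF E] carrier_matD[OF Wj(1)] carrier_matD[OF Wj(2), simplified] carrier_matD[OF Dc[OF s]]
    have Pj: "layer_prod d (W s) j N = P * W s (j + 1)"
      using layer_prod_step[OF w, of "j + 1" N] j by (simp add: P_def)
    have Ej: "end_to_end d (W s) j = W s j * E" using j by (cases j) (auto simp: E_def)
    have "G s j * transpose_mat (W s j) =
        (2 \<cdot>\<^sub>m (transpose_mat (P * W s (j + 1)) * D s * transpose_mat E)) * transpose_mat (W s j)"
      unfolding Gj[OF s j(1) less_imp_le[OF j(2)]] Pj E_def ..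
    also have "\<dots> = 2 \<cdot>\<^sub>m (transpose_mat (P * W s (j + 1)) * D s * transpose_mat E * transpose_mat (W s j))"
      by (rule mult_smult_assoc_mat[of _ "d j" "d (j - 1)" _ "d j"]) (auto intro!: carrier_matI)
    also have "transpose_mat (P * W s (j + 1)) * D s * transpose_mat E * transpose_mat (W s j) =
        transpose_mat (W s (j + 1)) * (transpose_mat P * D s * transpose_mat (W s j * E))"
      by (simp add: mat_dim_algebra)
    also have "2 \<cdot>\<^sub>m \<dots> = transpose_mat (W s (j + 1)) * (2 \<cdot>\<^sub>m (transpose_mat P * D s * transpose_mat (W s j * E)))"
      by (rule mult_smult_distrib[symmetric, of _ "d j" "d (j + 1)" _ "d j"]) (auto intro!: carrier_matI)
    also have "2 \<cdot>\<^sub>m (transpose_mat P * D s * transpose_mat (W s j * E)) = G s (j + 1)"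
      using Gj[OF s, of "j + 1"] j unfolding P_def Ej[symmetric] by simp
    finally show "G s j * transpose_mat (W s j) = transpose_mat (W s (j + 1)) * G s (j + 1)" .
  qed
  have rN: "r ^ N = c\<^sup>2"
  proof -
    have "r ^ N = r powr real N" using c0 by (simp add: r_def powr_realpow)
    also have "\<dots> = c powr 2" using depth by (simp add: r_def powr_powr)
    finally show ?thesis using c0 by simp
  qed
  \<comment> \<open>A Polyak-Lojasiewicz inequality: each of the \<open>N\<close> layers contributes
    the same bound, and the 4 is the square of the factor 2 in the gradient.\<close>
  have PL: "4 * real N * r ^ (N - 1) * f (W t) \<le> params_inner N d (G t) (G t)" if t: "0 \<le> t" for t
  proof -
    define F where "F = 1\<^sub>m n - T t"
    note [simp] = carrier_matD[OF Xc[OF t]] carrier_matD[OF T(1)[OF t]]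
    have F: "F \<in> carrier_mat (d N) (d N)" "transpose_mat F = F"
      by (auto simp: F_def widths transpose_minus_dim T(2)[OF t] intro!: carrier_matI)
    have DF: "D t = F * end_to_end d (W t) N"
      by (simp add: D_def F_def minus_mult_distrib_dim left_mult_one_dim flip: X_def)
    have low: "4 * (r ^ (N - 1) * f (W t)) \<le> frob_inner (G t j) (G t j)" if j: "j \<in> {1..N}" for j
    proof -
      define M where "M = transpose_mat (layer_prod d (W t) j N) * D t * transpose_mat (end_to_end d (W t) (j - 1))"
      have "r ^ (N - 1) * frob_inner (D t) (D t) \<le> frob_inner M M"
        unfolding M_def DF
      proof (rule balanced_gradient_lower_bound[OF depth Wp[OF t] bal[OF t] _ _ F])
        show "0 \<le> r" by (simp add: r_def)
        show "r ^ N * frob_inner Y Y \<le> frob_inner (transpose_mat (end_to_end d (W t) N) * Y)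
            (transpose_mat (end_to_end d (W t) N) * Y)" if "dim_row Y = d N" for Y
          using sing[OF t, of Y] that widths by (simp add: rN X_def)
      qed (use j in auto)
      moreover have "G t j = 2 \<cdot>\<^sub>m M" using Gj[OF t, of j] j by (simp add: M_def)
      then have "frob_inner (G t j) (G t j) = 4 * frob_inner M M"
        by (simp add: frob_inner_smult_left frob_inner_smult_right)
      moreover have "f (W t) = frob_inner (D t) (D t)" using T(4)[OF t] by (simp add: D_def)
      ultimately show ?thesis by simp
    qed
    have "4 * real N * r ^ (N - 1) * f (W t) = (\<Sum>j\<in>{1..N}. 4 * (r ^ (N - 1) * f (W t)))" by simp
    also have "\<dots> \<le> (\<Sum>j\<in>{1..N}. frob_inner (G t j) (G t j))" using low by (rule sum_mono)
    also have "\<dots> = params_inner N d (G t) (G t)"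
      by (rule params_inner_eq_sum_frob_inner[OF Gp[OF t], symmetric])
    finally show ?thesis .
  qed
  define k where "k = 8 * real N * c powr (2 * (2 * real N - 1) / real N) * K"
  have fnonneg: "0 \<le> f (W t)" if "0 \<le> t" for t
    using T(4)[OF that] frob_inner_self_nonneg by simp
  \<comment> \<open>The loss and \<open>lambda_min \<Sigma>\<^sub>0\<close> are nonnegative, so
    \<open>C\<close> is at least \<open>mat_trace \<Sigma>\<^sub>0\<close>, which dominates the
    smallest eigenvalue.\<close>
  have "\<sigma>\<^sup>2 \<le> C"
    using lambda_min_le_trace[OF S0 n] lambda_min_nonneg[OF S0 n] fnonneg[of 0] by (simp add: C \<sigma>2 fX \<Sigma>X)
  then have k: "k \<le> 4 * real N * r ^ (N - 1)"
    unfolding k_def r_def by (rule decay_rate_le[OF depth c0 cs]) (simp add: K \<sigma>2)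
  have decay: "f (W t) \<le> exp (- k * t) * f (W 0)" if t: "0 \<le> t" for t
  proof (rule exponential_decay[OF f' _ t])
    fix s :: real assume s: "0 \<le> s"
    have "k * f (W s) \<le> 4 * real N * r ^ (N - 1) * f (W s)"
      using k fnonneg[OF s] by (rule mult_right_mono)
    then show "- params_inner N d (G s) (G s) \<le> - k * f (W s)" using PL[OF s] by simp
  qed
  have "BW_loss \<Sigma>\<^sub>0 \<Sigma>star = 0" using BW_loss_self[OF Sigma0] Sigma_star by simp
  then show ?thesis using decay by (simp add: fX \<Sigma>X k_def)
qed

end
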